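(* Let $0<\alpha<1$, let $k\ge1$ be an integer, $\varrho\in[0,1)$ and $\lambda>0$, and let $N_\alpha^h(t)=N_{PAk}(Y_\alpha(t))$, $t\ge0$, be the fractional P\'olya-Aeppli process of order $k$, where $N_{PAk}$ is the P\'olya-Aeppli process of order $k$ with intensity $\lambda$ and parameter $\varrho$ and $Y_\alpha$ is an inverse $\alpha$-stable subordinator independent of $N_{PAk}$. Then the process $\{N_\alpha^h(t);\,t\ge 0\}$ has the long-range dependence property.
   Context: P\'olya-Aeppli process of order $k$ with intensity $\lambda$ and parameter $\varrho$: $N_{PAk}(t)=X_1+\dots+X_{N_1(t)}$ (an empty sum being $0$), where $N_1$ is a homogeneous Poisson process with intensity $\lambda$ and $X_1,X_2,\dots$ are i.i.d., independent of $N_1$, with the truncated geometric distribution $$\mathbb{P}[X_i=m]=\frac{1-\varrho}{1-\varrho^k}\varrho^{m-1},\qquad m=1,2,\dots,k,$$ with the convention $0^0=1$. Inverse $\alpha$-stable subordinator: let $\{\mathcal{L}_\alpha(t);\,t\ge 0\}$ be the $\alpha$-stable L\'evy subordinator, i.e. the L\'evy process with $\mathbb{E}[e^{-s\mathcal{L}_\alpha(t)}]=e^{-ts^\alpha}$, $s\ge 0$. Then $Y_\alpha(t)=\inf\{u>0:\mathcal{L}_\alpha(u)>t\}$, $t\ge 0$. Long-range dependence (LRD) property: a process $\{X(t);\,t\ge 0\}$ has the LRD property if there is an exponent $d\in(0,1)$ such that for every fixed $s>0$ there is a constant $c(s)\in(0,\infty)$ with $$\lim_{t\to\infty}\frac{\mathrm{Corr}(X(s),X(t))}{t^{-d}}=c(s),$$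 where $\mathrm{Corr}$ denotes the correlation function of the process $X$. *)

theory Defs
  imports "HOL-Probability.Probability"
begin

text \<open>
  Path properties and path equations are required almost surely only, and every process comes
  with the assumption that each of its marginals is a random variable.  Times are nonnegative:
  the values of a process at negative times are irrelevant.
\<close>

definition cadlag :: "(real \<Rightarrow> real) \<Rightarrow> bool" where
  "cadlag f \<longleftrightarrow>
     (\<forall>t\<ge>0. (f \<longlongrightarrow> f t) (at_right t)) \<and>
     (\<forall>t>0. \<exists>l. (f \<longlongrightarrow> l) (at_left t))"

definition (in prob_space) real_process :: "(real \<Rightarrow> 'a \<Rightarrow> real) \<Rightarrow> bool" where
  "real_process X \<longleftrightarrow> (\<forall>t\<ge>0. random_variable borel (X t))"

text \<open>The sigma-algebra on the sample space generated by the family \<open>(X i)\<^sub>i\<close> with \<open>i \<in> I\<close>.\<close>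

definition (in prob_space) generated_events ::
    "'i set \<Rightarrow> ('i \<Rightarrow> 'a \<Rightarrow> 'b::topological_space) \<Rightarrow> 'a set set" where
  "generated_events I X =
     sets (vimage_algebra (space M) (\<lambda>\<omega>. \<lambda>i\<in>I. X i \<omega>) (\<Pi>\<^sub>M i\<in>I. borel))"

definition (in prob_space) indep_families ::
    "'i set \<Rightarrow> ('i \<Rightarrow> 'a \<Rightarrow> 'b::topological_space) \<Rightarrow>
     'j set \<Rightarrow> ('j \<Rightarrow> 'a \<Rightarrow> 'c::topological_space) \<Rightarrow> bool" where
  "indep_families I X J Y \<longleftrightarrow> indep_set (generated_events I X) (generated_events J Y)"

text \<open>
  Finitely many increments are covered by the infinite sequences below, since \<open>ts\<close> may be
  eventually constant.  Stochastic continuity follows from cadlag paths and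
  stationary increments.
\<close>

definition (in prob_space) levy_process :: "(real \<Rightarrow> 'a \<Rightarrow> real) \<Rightarrow> bool" where
  "levy_process X \<longleftrightarrow>
     real_process X \<and>
     (AE \<omega> in M. X 0 \<omega> = 0) \<and>
     (\<forall>ts :: nat \<Rightarrow> real. 0 \<le> ts 0 \<longrightarrow> mono ts \<longrightarrow>
        indep_vars (\<lambda>_. borel) (\<lambda>i \<omega>. X (ts (Suc i)) \<omega> - X (ts i) \<omega>) UNIV) \<and>
     (\<forall>s\<ge>0. \<forall>h\<ge>0. distr M borel (\<lambda>\<omega>. X (s + h) \<omega> - X s \<omega>) = distr M borel (X h)) \<and>
     (AE \<omega> in M. cadlag (\<lambda>t. X t \<omega>))"

text \<open>
  A homogeneous Poisson process as a Levy process with values in the natural numbers and Poisson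
  marginals; its paths are then almost surely nondecreasing.
\<close>

definition (in prob_space) poisson_process :: "real \<Rightarrow> (real \<Rightarrow> 'a \<Rightarrow> nat) \<Rightarrow> bool" where
  "poisson_process lam N1 \<longleftrightarrow>
     levy_process (\<lambda>t \<omega>. real (N1 t \<omega>)) \<and>
     (\<forall>t\<ge>0. \<forall>n. \<P>(\<omega> in M. N1 t \<omega> = n) = exp (- (lam * t)) * (lam * t) ^ n / fact n)"

text \<open>The power \<open>\<rho> ^ (m - 1)\<close> has a natural exponent, hence \<open>0 ^ 0 = 1\<close>.\<close>

definition (in prob_space) truncated_geometric :: "nat \<Rightarrow> real \<Rightarrow> ('a \<Rightarrow> nat) \<Rightarrow> bool" where
  "truncated_geometric k \<rho> X \<longleftrightarrow>
     random_variable (count_space UNIV) X \<and>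
     (\<forall>m\<in>{1..k}. \<P>(\<omega> in M. X \<omega> = m) = (1 - \<rho>) / (1 - \<rho> ^ k) * \<rho> ^ (m - 1))"

definition (in prob_space) polya_aeppli_process ::
    "nat \<Rightarrow> real \<Rightarrow> real \<Rightarrow> (real \<Rightarrow> 'a \<Rightarrow> real) \<Rightarrow> bool" where
  "polya_aeppli_process k lam \<rho> N \<longleftrightarrow>
     real_process N \<and>
     (\<exists>(N1 :: real \<Rightarrow> 'a \<Rightarrow> nat) (X :: nat \<Rightarrow> 'a \<Rightarrow> nat).
        poisson_process lam N1 \<and>
        (\<forall>i\<ge>1. truncated_geometric k \<rho> (X i)) \<and>
        indep_vars (\<lambda>_. count_space UNIV) X {1..} \<and>
        indep_families {0..} N1 {1..} X \<and>
        (AE \<omega> in M. \<forall>t\<ge>0. N t \<omega> = real (\<Sum>i=1..N1 t \<omega>. X i \<omega>)))"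

definition (in prob_space) stable_subordinator :: "real \<Rightarrow> (real \<Rightarrow> 'a \<Rightarrow> real) \<Rightarrow> bool" where
  "stable_subordinator \<alpha> L \<longleftrightarrow>
     levy_process L \<and>
     (AE \<omega> in M. mono_on {0..} (\<lambda>t. L t \<omega>)) \<and>
     (\<forall>t\<ge>0. \<forall>s\<ge>0. expectation (\<lambda>\<omega>. exp (- s * L t \<omega>)) = exp (- t * s powr \<alpha>))"

text \<open>
  The set under the infimum is almost surely nonempty for all \<open>t\<close>, because the paths of a stable
  subordinator are almost surely unbounded.
\<close>

definition (in prob_space) inverse_stable_subordinator ::
    "real \<Rightarrow> (real \<Rightarrow> 'a \<Rightarrow> real) \<Rightarrow> bool" where
  "inverse_stable_subordinator \<alpha> Y \<longleftrightarrow>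
     real_process Y \<and>
     (\<exists>L. stable_subordinator \<alpha> L \<and>
        (AE \<omega> in M. \<forall>t\<ge>0. Y t \<omega> = Inf {u. u > 0 \<and> L u \<omega> > t}))"

definition (in prob_space) covariance :: "('a \<Rightarrow> real) \<Rightarrow> ('a \<Rightarrow> real) \<Rightarrow> real" where
  "covariance X Y = expectation (\<lambda>\<omega>. (X \<omega> - expectation X) * (Y \<omega> - expectation Y))"

definition (in prob_space) correlation :: "('a \<Rightarrow> real) \<Rightarrow> ('a \<Rightarrow> real) \<Rightarrow> real" where
  "correlation X Y = covariance X Y / (sqrt (variance X) * sqrt (variance Y))"

text \<open>
  The correlation of random variables without finite positive variances is 0 by the library's
  conventions for integrals and division, so the positive limit below is not attained by such
  junk values.
\<close>

definition (in prob_space) long_range_dependent :: "(real \<Rightarrow> 'a \<Rightarrow> real) \<Rightarrow> bool" where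
  "long_range_dependent X \<longleftrightarrow>
     (\<exists>d. 0 < d \<and> d < 1 \<and>
        (\<forall>s>0. \<exists>c>0. ((\<lambda>t. correlation (X s) (X t) / t powr (- d)) \<longlongrightarrow> c) at_top))"

end

theory Submission
  imports Defs
begin

text \<open>
  The process decorrelates with exponent \<open>\<alpha>\<close>.  Write \<open>\<mu> = \<lambda> * E X\<close> and \<open>\<kappa> = \<lambda> * E (X\<^sup>2)\<close> for the mean and
  the variance of the Polya-Aeppli process \<open>N\<close> per unit of time, \<open>X\<close> being a jump.  As \<open>N\<close> and \<open>Y\<close> are
  independent, for \<open>s \<le> t\<close> the covariance of \<open>N (Y s)\<close> and \<open>N (Y t)\<close> is
  \<open>\<kappa> * E (Y s) + \<mu>\<^sup>2 * Cov (Y s, Y t)\<close>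
  (\<open>Nh_covariance\<close>), and everything is reduced to the first two moments of \<open>Y\<close>.

  Self-similarity of the stable subordinator \<open>L\<close> gives \<open>E (Y t) = t powr \<alpha> * E (Y 1)\<close> and the
  corresponding formula for second moments, so that \<open>Var (N (Y t))\<close> grows like a multiple of
  \<open>t powr (2 * \<alpha>)\<close>, the factor being positive because \<open>Y 1\<close> is not constant (\<open>variance_Y_pos\<close>).

  The covariance of \<open>Y s\<close> and \<open>Y t\<close> converges to \<open>E ((Y s)\<^sup>2) / 2\<close> as \<open>t\<close> tends to infinity
  (\<open>Y_covariance_tendsto\<close>).  Indeed \<open>E (Y s * Y t)\<close> is the double integral of
  \<open>P (L u \<le> s, L v \<le> t)\<close>; for \<open>v < u\<close> the second condition is void and the contribution is
  \<open>E ((Y s)\<^sup>2) / 2\<close>, while for \<open>u < v\<close> the independence of \<open>L u\<close> and \<open>L v - L u\<close> confines the contribution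
  between \<open>E (Y s) * E (Y (t - s))\<close> and \<open>E (Y s) * E (Y t)\<close> (\<open>expectation_Y_mult_bounds\<close>).  The
  difference of these bounds tends to 0 since \<open>\<alpha> < 1\<close>.

  Therefore \<open>Corr (N (Y s), N (Y t)) * t powr \<alpha>\<close> has a positive finite limit.

  The substitution of the random time \<open>Y t\<close> into \<open>N\<close> is justified by monotone paths: \<open>N (Y t)\<close> lies
  between the values of \<open>N\<close> at the points of a grid below and above \<open>Y t\<close>, where independence can be used
  for countably many values separately (\<open>nn_integral_indep_index\<close>), and the mesh then tends to 0.
\<close>

section \<open>Laplace transforms, tails and random indices\<close>

context prob_space
begin

text \<open>
  The variable \<open>exp (- X)\<close> takes values in the unit interval, and its moments are the values of the
  Laplace transform of \<open>X\<close> at the natural numbers.  A bounded variable has an everywhere convergent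
  expansion of its characteristic function in terms of its moments, so Levy's uniqueness theorem
  identifies its law, and taking logarithms recovers the law of \<open>X\<close>.
\<close>

lemma distr_eqI_Laplace:
  assumes [measurable]: "random_variable borel X" "random_variable borel Z"
    and X: "AE \<omega> in M. 0 \<le> X \<omega>" and Z: "AE \<omega> in M. 0 \<le> Z \<omega>"
    and eq: "\<And>n::nat. expectation (\<lambda>\<omega>. exp (- real n * X \<omega>)) = expectation (\<lambda>\<omega>. exp (- real n * Z \<omega>))"
  shows "distr M borel X = distr M borel Z"
proof -
  define e where "e W \<omega> = exp (- W \<omega>)" for W :: "'a \<Rightarrow> real" and \<omega>
  have pow: "e W \<omega> ^ n = exp (- real n * W \<omega>)" for W \<omega> n
    by (simp add: e_def exp_of_nat_mult[symmetric])
  have meas[measurable]: "random_variable borel (e W)" if "random_variable borel W" for W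
    using that unfolding e_def by measurable
  have int: "integrable M (\<lambda>\<omega>. e W \<omega> ^ n)" if "random_variable borel W" "AE \<omega> in M. 0 \<le> W \<omega>" for W n
  proof (rule integrable_const_bound[where B=1])
    show "AE \<omega> in M. norm (e W \<omega> ^ n) \<le> 1"
      using that(2) by eventually_elim (simp add: e_def power_le_one)
  qed (use meas[OF that(1)] in simp)
  \<comment> \<open>The moments of a variable in the unit interval are at most 1, which bounds the remainder.\<close>
  have approx: "(\<lambda>n. \<Sum>k\<le>n. ((\<i> * t)^k / fact k) * of_real (expectation (\<lambda>\<omega>. e W \<omega> ^ k)))
      \<longlonglongrightarrow> char (distr M borel (e W)) t"
    if W: "random_variable borel W" "AE \<omega> in M. 0 \<le> W \<omega>" for W t
  proof (rule LIM_zero_cancel, rule tendsto_norm_zero_cancel, rule Lim_null_comparison)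
    show "(\<lambda>n. 2 * (\<bar>t\<bar>^n / fact n)) \<longlonglongrightarrow> 0"
      using summable_LIMSEQ_zero[OF summable_exp[of "\<bar>t\<bar>"]]
      by (intro tendsto_mult_right_zero) (simp add: divide_inverse mult.commute)
    show "\<forall>\<^sub>F n in sequentially. norm (norm ((\<Sum>k\<le>n. ((\<i> * t)^k / fact k) * of_real (expectation (\<lambda>\<omega>. e W \<omega> ^ k)))
        - char (distr M borel (e W)) t)) \<le> 2 * (\<bar>t\<bar>^n / fact n)"
    proof (rule always_eventually, rule allI)
      fix n
      have "expectation (\<lambda>\<omega>. \<bar>e W \<omega>\<bar> ^ n) \<le> 1"
      proof (rule integral_le_const)
        show "integrable M (\<lambda>\<omega>. \<bar>e W \<omega>\<bar> ^ n)" using int[OF W, of n] by (simp add: e_def)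
        show "AE \<omega> in M. \<bar>e W \<omega>\<bar> ^ n \<le> 1"
          using W(2) by eventually_elim (simp add: e_def power_le_one)
      qed
      then have "(2 * \<bar>t\<bar>^n / fact n) * expectation (\<lambda>\<omega>. \<bar>e W \<omega>\<bar> ^ n) \<le> (2 * \<bar>t\<bar>^n / fact n) * 1"
        by (intro mult_left_mono) auto
      with char_approx1'[of n "e W" "distr M borel (e W)" t] int[OF W] meas[OF W(1)]
      show "norm (norm ((\<Sum>k\<le>n. ((\<i> * t)^k / fact k) * of_real (expectation (\<lambda>\<omega>. e W \<omega> ^ k)))
        - char (distr M borel (e W)) t)) \<le> 2 * (\<bar>t\<bar>^n / fact n)"
        by (simp add: norm_minus_commute)
    qed
  qed
  have "char (distr M borel (e X)) = char (distr M borel (e Z))"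
  proof
    fix t
    have "expectation (\<lambda>\<omega>. e X \<omega> ^ k) = expectation (\<lambda>\<omega>. e Z \<omega> ^ k)" for k
      by (simp only: pow eq)
    with approx[OF assms(2) Z, of t] approx[OF assms(1) X, of t]
    show "char (distr M borel (e X)) t = char (distr M borel (e Z)) t"
      by (simp only: LIMSEQ_unique)
  qed
  then have "distr M borel (e X) = distr M borel (e Z)"
    by (intro Levy_uniqueness) (auto intro!: real_distribution_distr)
  then have "distr (distr M borel (e X)) borel (\<lambda>x. - ln x) = distr (distr M borel (e Z)) borel (\<lambda>x. - ln x)"
    by simp
  then show ?thesis
    by (simp add: distr_distr comp_def e_def)
qed

text \<open>
  Fubini's theorem for the region \<open>0 < u < Z \<omega>\<close>.  With \<open>h u = 1\<close> and \<open>h u = 2 u\<close> the inner integral is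
  \<open>Z\<close> and \<open>Z\<^sup>2\<close>, so first and second moments are determined by the tail of \<open>Z\<close> at almost all levels.
\<close>

lemma nn_integral_layer_cake:
  fixes h :: "real \<Rightarrow> ennreal"
  assumes [measurable]: "random_variable borel Z" "h \<in> borel_measurable borel"
  shows "(\<integral>\<^sup>+\<omega>. (\<integral>\<^sup>+u. h u * indicator {0<..<Z \<omega>} u \<partial>lborel) \<partial>M)
    = (\<integral>\<^sup>+u. h u * indicator {0<..} u * emeasure M {\<omega>\<in>space M. u < Z \<omega>} \<partial>lborel)"
proof -
  interpret L: pair_sigma_finite M "lborel :: real measure" ..
  have eq: "h u * indicator {0<..<Z \<omega>} u = h u * indicator {0<..} u * indicator {\<omega>\<in>space M. u < Z \<omega>} \<omega>"
    if "\<omega> \<in> space M" for \<omega> u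
    using that by (auto split: split_indicator)
  have "(\<integral>\<^sup>+\<omega>. (\<integral>\<^sup>+u. h u * indicator {0<..<Z \<omega>} u \<partial>lborel) \<partial>M)
      = (\<integral>\<^sup>+\<omega>. (\<integral>\<^sup>+u. h u * indicator {0<..} u * indicator {\<omega>\<in>space M. u < Z \<omega>} \<omega> \<partial>lborel) \<partial>M)"
    by (intro nn_integral_cong) (simp add: eq)
  also have "\<dots> = (\<integral>\<^sup>+u. (\<integral>\<^sup>+\<omega>. h u * indicator {0<..} u * indicator {\<omega>\<in>space M. u < Z \<omega>} \<omega> \<partial>M) \<partial>lborel)"
    by (rule L.Fubini'[symmetric]) measurable
  also have "\<dots> = (\<integral>\<^sup>+u. h u * indicator {0<..} u * emeasure M {\<omega>\<in>space M. u < Z \<omega>} \<partial>lborel)"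
    by (intro nn_integral_cong nn_integral_cmult_indicator) measurable
  finally show ?thesis .
qed

lemma nn_integral_indicator_Ioo: "(\<integral>\<^sup>+u. indicator {0<..<z::real} u \<partial>lborel) = ennreal z"
  by (cases "0 \<le> z") (auto simp: ennreal_neg)

lemma nn_integral_linear_Ioo: "(\<integral>\<^sup>+u. ennreal (2 * u) * indicator {0<..<z::real} u \<partial>lborel) = ennreal ((max 0 z)\<^sup>2)"
proof (cases "0 \<le> z")
  case True
  have "(\<integral>\<^sup>+u. ennreal (2 * u) * indicator {0<..<z::real} u \<partial>lborel)
     = (\<integral>\<^sup>+u. ennreal (2 * u) * indicator {0..z::real} u \<partial>lborel)"
    by (intro nn_integral_cong_AE) (use AE_lborel_singleton[of 0] AE_lborel_singleton[of z] in
      \<open>eventually_elim, auto split: split_indicator\<close>)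
  also have "\<dots> = z\<^sup>2 - 0\<^sup>2"
    by (rule nn_integral_FTC_Icc) (use True in \<open>auto intro!: derivative_eq_intros\<close>)
  finally show ?thesis using True by simp
qed simp

lemma nn_integral_tail:
  assumes "random_variable borel Z"
  shows "(\<integral>\<^sup>+\<omega>. ennreal (Z \<omega>) \<partial>M)
    = (\<integral>\<^sup>+u. indicator {0<..} u * emeasure M {\<omega>\<in>space M. u < Z \<omega>} \<partial>lborel)"
  using nn_integral_layer_cake[OF assms, of "\<lambda>_. 1"] by (simp add: nn_integral_indicator_Ioo)

lemma nn_integral_tail_square:
  assumes "random_variable borel Z"
  shows "(\<integral>\<^sup>+\<omega>. ennreal ((max 0 (Z \<omega>))\<^sup>2) \<partial>M)
    = (\<integral>\<^sup>+u. ennreal (2 * u) * indicator {0<..} u * emeasure M {\<omega>\<in>space M. u < Z \<omega>} \<partial>lborel)"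
  using nn_integral_layer_cake[OF assms, of "\<lambda>u. ennreal (2 * u)"] by (simp add: nn_integral_linear_Ioo)

text \<open>
  A law has only countably many atoms.  This is what allows strict and weak inequalities in tails to
  be exchanged at almost every level.
\<close>

lemma AE_lborel_prob_eq_0:
  assumes [measurable]: "random_variable borel Z"
  shows "AE u in lborel. prob {\<omega>\<in>space M. Z \<omega> = u} = 0"
proof -
  interpret D: prob_space "distr M borel Z" by (rule prob_space_distr) measurable
  have "countable {u. prob {\<omega>\<in>space M. Z \<omega> = u} \<noteq> 0}"
    using D.countable_support by (simp add: measure_distr vimage_def Int_def conj_commute)
  then show ?thesis
    by (intro AE_I'[OF countable_imp_null_set_lborel]) auto
qed

lemma AE_lborel_AE_neq:
  assumes [measurable]: "random_variable borel Z"
  shows "AE u in lborel. AE \<omega> in M. Z \<omega> \<noteq> u"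
  using AE_lborel_prob_eq_0[OF assms]
  by eventually_elim (auto simp: AE_iff_measurable[OF _ refl] emeasure_eq_measure)

end

text \<open>
  Independence of an event from a sub-sigma-algebra factorises the integral of every nonnegative
  function measurable for the latter, by the usual induction from indicators.
\<close>

lemma indep_set_nn_integral:
  fixes f :: "'a \<Rightarrow> ennreal"
  assumes "prob_space M"
  assumes ind: "prob_space.indep_set M \<A> (sets G)" and sp: "space G = space M"
    and f: "f \<in> borel_measurable G" and A: "A \<in> \<A>"
  shows "(\<integral>\<^sup>+\<omega>. indicator A \<omega> * f \<omega> \<partial>M) = emeasure M A * (\<integral>\<^sup>+\<omega>. f \<omega> \<partial>M)"
proof -
  interpret prob_space M by fact
  have sub: "subalgebra M G" and [measurable]: "A \<in> sets M"
    using ind sp A by (auto simp: indep_sets2_eq subalgebra_def)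
  have M: "g \<in> borel_measurable M" if "g \<in> borel_measurable G" for g :: "'a \<Rightarrow> ennreal"
    using measurable_from_subalg[OF sub that] .
  from f show ?thesis
  proof induct
    case (cong f g)
    then show ?case
      by (simp add: sp cong: nn_integral_cong)
  next
    case (set B)
    then have [measurable]: "B \<in> sets M" using sub by (auto simp: subalgebra_def)
    have "(\<integral>\<^sup>+\<omega>. indicator A \<omega> * indicator B \<omega> \<partial>M) = emeasure M (A \<inter> B)"
      by (simp flip: indicator_inter_arith)
    then show ?case
      using indep_setD[OF ind A set] by (simp add: emeasure_eq_measure ennreal_mult)
  next
    case (mult u c)
    note [measurable] = M[OF mult(2)]
    have "(\<integral>\<^sup>+\<omega>. indicator A \<omega> * (c * u \<omega>) \<partial>M) = (\<integral>\<^sup>+\<omega>. c * (indicator A \<omega> * u \<omega>) \<partial>M)"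
      by (simp add: ac_simps)
    then show ?case
      using mult(4) by (simp add: nn_integral_cmult ac_simps)
  next
    case (add u v)
    note [measurable] = M[OF add(1)] M[OF add(4)]
    show ?case
      using add(3,7) by (simp add: nn_integral_add distrib_left)
  next
    case (seq U)
    note [measurable] = M[OF seq(1)]
    have "(\<integral>\<^sup>+\<omega>. indicator A \<omega> * (SUP i. U i) \<omega> \<partial>M) = (\<integral>\<^sup>+\<omega>. (SUP i. indicator A \<omega> * U i \<omega>) \<partial>M)"
      by (simp add: SUP_mult_left_ennreal image_comp)
    also have "\<dots> = (SUP i. \<integral>\<^sup>+\<omega>. indicator A \<omega> * U i \<omega> \<partial>M)"
      using seq by (intro nn_integral_monotone_convergence_SUP)
        (auto simp: incseq_def le_fun_def intro!: mult_left_mono)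
    also have "\<dots> = (SUP i. emeasure M A * (\<integral>\<^sup>+\<omega>. U i \<omega> \<partial>M))"
      using seq by simp
    also have "\<dots> = emeasure M A * (SUP i. (\<integral>\<^sup>+\<omega>. U i \<omega> \<partial>M))"
      by (simp add: SUP_mult_left_ennreal)
    also have "(SUP i. (\<integral>\<^sup>+\<omega>. U i \<omega> \<partial>M)) = (\<integral>\<^sup>+\<omega>. (SUP i. U i \<omega>) \<partial>M)"
      using seq by (intro nn_integral_monotone_convergence_SUP[symmetric]) auto
    finally show ?case by (simp add: image_comp)
  qed
qed

context prob_space
begin

lemma nn_integral_nat_valued:
  fixes W :: "nat \<Rightarrow> 'a \<Rightarrow> ennreal"
  assumes [measurable]: "K \<in> measurable M (count_space UNIV)" and [measurable]: "\<And>j. W j \<in> borel_measurable M"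
  shows "(\<integral>\<^sup>+\<omega>. W (K \<omega>) \<omega> \<partial>M) = (\<Sum>j. \<integral>\<^sup>+\<omega>. indicator {\<omega>\<in>space M. K \<omega> = j} \<omega> * W j \<omega> \<partial>M)"
proof -
  have "W (K \<omega>) \<omega> = (\<Sum>j. indicator {\<omega>\<in>space M. K \<omega> = j} \<omega> * W j \<omega>)" if "\<omega> \<in> space M" for \<omega>
    using that by (subst suminf_finite[where N="{K \<omega>}"]) (auto split: split_indicator)
  then have "(\<integral>\<^sup>+\<omega>. W (K \<omega>) \<omega> \<partial>M) = (\<integral>\<^sup>+\<omega>. (\<Sum>j. indicator {\<omega>\<in>space M. K \<omega> = j} \<omega> * W j \<omega>) \<partial>M)"
    by (intro nn_integral_cong) auto
  also have "\<dots> = (\<Sum>j. \<integral>\<^sup>+\<omega>. indicator {\<omega>\<in>space M. K \<omega> = j} \<omega> * W j \<omega> \<partial>M)"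
    by (rule nn_integral_suminf) measurable
  finally show ?thesis .
qed

text \<open>
  If the random index \<open>K\<close> is independent of the whole family \<open>W\<close>, then the index may be frozen while
  \<open>W\<close> is integrated out.  This replaces conditional expectations in the computation of
  moments of \<open>W\<close> at a random index.
\<close>

lemma nn_integral_indep_index:
  fixes W :: "nat \<Rightarrow> 'a \<Rightarrow> ennreal"
  assumes ind: "indep_set (sets F) (sets G)" and sp: "space F = space M" "space G = space M"
    and K: "K \<in> measurable F (count_space UNIV)" and W: "\<And>j. W j \<in> borel_measurable G"
  shows "(\<integral>\<^sup>+\<omega>. W (K \<omega>) \<omega> \<partial>M) = (\<integral>\<^sup>+\<omega>. (\<integral>\<^sup>+\<omega>'. W (K \<omega>) \<omega>' \<partial>M) \<partial>M)"
proof -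
  have F: "subalgebra M F" and G: "subalgebra M G"
    using ind sp by (auto simp: indep_sets2_eq subalgebra_def)
  have ev: "{\<omega>\<in>space M. K \<omega> = j} \<in> sets F" for j
    using measurable_sets[OF K, of "{j}"] by (simp add: vimage_def Int_def sp conj_commute)
  have "(\<integral>\<^sup>+\<omega>. W (K \<omega>) \<omega> \<partial>M) = (\<Sum>j. \<integral>\<^sup>+\<omega>. indicator {\<omega>\<in>space M. K \<omega> = j} \<omega> * W j \<omega> \<partial>M)"
    by (rule nn_integral_nat_valued[OF measurable_from_subalg[OF F K] measurable_from_subalg[OF G W]])
  also have "\<dots> = (\<Sum>j. emeasure M {\<omega>\<in>space M. K \<omega> = j} * (\<integral>\<^sup>+\<omega>'. W j \<omega>' \<partial>M))"
    by (intro suminf_cong indep_set_nn_integral[OF prob_space_axioms ind sp(2)] W ev)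
  also have "\<dots> = (\<Sum>j. \<integral>\<^sup>+\<omega>. indicator {\<omega>\<in>space M. K \<omega> = j} \<omega> * (\<integral>\<^sup>+\<omega>'. W j \<omega>' \<partial>M) \<partial>M)"
  proof -
    have [measurable]: "{\<omega>\<in>space M. K \<omega> = j} \<in> events" for j
      using ev F by (auto simp: subalgebra_def)
    show ?thesis
      by (intro suminf_cong) (subst nn_integral_multc, simp_all add: nn_integral_indicator)
  qed
  also have "\<dots> = (\<integral>\<^sup>+\<omega>. (\<integral>\<^sup>+\<omega>'. W (K \<omega>) \<omega>' \<partial>M) \<partial>M)"
    by (rule nn_integral_nat_valued[symmetric]) (rule measurable_from_subalg[OF F K], simp)
  finally show ?thesis .
qed

lemma nn_integral_indep_index2:
  fixes W :: "nat \<Rightarrow> nat \<Rightarrow> 'a \<Rightarrow> ennreal"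
  assumes "indep_set (sets F) (sets G)" "space F = space M" "space G = space M"
    and "K \<in> measurable F (count_space UNIV)" "K' \<in> measurable F (count_space UNIV)"
    and W: "\<And>i j. W i j \<in> borel_measurable G"
  shows "(\<integral>\<^sup>+\<omega>. W (K \<omega>) (K' \<omega>) \<omega> \<partial>M) = (\<integral>\<^sup>+\<omega>. (\<integral>\<^sup>+\<omega>'. W (K \<omega>) (K' \<omega>) \<omega>' \<partial>M) \<partial>M)"
proof -
  have "(\<lambda>\<omega>. prod_encode (K \<omega>, K' \<omega>)) \<in> measurable F (count_space UNIV)"
    by (rule measurable_compose[OF measurable_Pair[OF assms(4,5)]]) (simp add: pair_measure_countable)
  from nn_integral_indep_index[OF assms(1-3) this, of "\<lambda>n. W (fst (prod_decode n)) (snd (prod_decode n))"] W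
  show ?thesis
    by simp
qed

end

section \<open>Increments of Levy processes\<close>

context prob_space
begin

lemma indep_vars_imp_indep_var:
  assumes "indep_vars (\<lambda>_. S) X I" "i \<in> I" "j \<in> I" "i \<noteq> j"
  shows "indep_var S (X i) S (X j)"
proof -
  let ?F = "\<lambda>i. sigma_sets (space M) {X i -` A \<inter> space M |A. A \<in> sets S}"
  from assms have rv: "random_variable S (X i)" "random_variable S (X j)" and F: "indep_sets ?F I"
    by (auto simp: indep_vars_def)
  have "prob (a \<inter> b) = prob a * prob b" if "a \<in> ?F i" "b \<in> ?F j" for a b
    using indep_setsD[OF F, of "{i, j}" "\<lambda>k. if k = i then a else b"] that assms(2-) by (auto simp: Int_commute)
  moreover have "?F i \<subseteq> events" "?F j \<subseteq> events"
    using F assms by (auto simp: indep_sets_def)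
  ultimately show ?thesis
    by (simp add: indep_var_eq rv indep_sets2_eq)
qed

lemma levy_process_rv: "levy_process X \<Longrightarrow> 0 \<le> t \<Longrightarrow> random_variable borel (X t)"
  by (simp add: levy_process_def real_process_def)

lemma levy_process_indep_increments:
  assumes "levy_process X" "0 \<le> a" "a \<le> b"
  shows "indep_var borel (\<lambda>\<omega>. X a \<omega> - X 0 \<omega>) borel (\<lambda>\<omega>. X b \<omega> - X a \<omega>)"
proof -
  \<comment> \<open>The times 0, a, b, b, ...: the sequence may stay at b once the two increments have been formed.\<close>
  define ts :: "nat \<Rightarrow> real" where "ts i = (if i = 0 then 0 else if i = 1 then a else b)" for i
  have "mono ts" "0 \<le> ts 0"
    using assms(2,3) by (auto simp: ts_def mono_def)
  with assms(1) have "indep_vars (\<lambda>_. borel) (\<lambda>i \<omega>. X (ts (Suc i)) \<omega> - X (ts i) \<omega>) UNIV"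
    by (simp add: levy_process_def)
  from indep_vars_imp_indep_var[OF this, of 0 1] show ?thesis
    by (simp add: ts_def)
qed

lemma levy_process_increment:
  assumes "levy_process X" "0 \<le> a" "a \<le> b"
  shows "distr M borel (\<lambda>\<omega>. X b \<omega> - X a \<omega>) = distr M borel (X (b - a))"
proof -
  have "\<forall>s\<ge>0. \<forall>h\<ge>0. distr M borel (\<lambda>\<omega>. X (s + h) \<omega> - X s \<omega>) = distr M borel (X h)"
    using assms(1) by (simp add: levy_process_def)
  from this[rule_format, of a "b - a"] assms(2,3) show ?thesis
    by simp
qed

lemma prob_eq_if_distr_eq:
  assumes "distr M borel X = distr M borel Z" "random_variable borel X" "random_variable borel Z"
    "A \<in> sets borel"
  shows "prob (X -` A \<inter> space M) = prob (Z -` A \<inter> space M)"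
  using arg_cong[OF assms(1), of "\<lambda>D. measure D A"] assms(2-) by (simp add: measure_distr)

end

section \<open>The inverse stable subordinator\<close>

text \<open>
  The area of \<open>{(u, v). 0 < u < v, u < a, v < b}\<close>, that is, of the rectangle with sides \<open>a \<le> b\<close> without
  the triangle below the diagonal.
\<close>

lemma nn_integral_trapezoid:
  fixes a b :: real
  assumes "0 \<le> a" "a \<le> b"
  shows "(\<integral>\<^sup>+u. ennreal (b - u) * indicator {0<..<a} u \<partial>lborel) = ennreal (a * b - a\<^sup>2 / 2)"
proof -
  have "(\<integral>\<^sup>+u. ennreal (b - u) * indicator {0<..<a} u \<partial>lborel)
     = (\<integral>\<^sup>+u. ennreal (b - u) * indicator {0..a} u \<partial>lborel)"
    by (intro nn_integral_cong_AE) (use AE_lborel_singleton[of 0] AE_lborel_singleton[of a] in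
      \<open>eventually_elim, auto split: split_indicator\<close>)
  also have "\<dots> = ennreal ((b * a - a\<^sup>2 / 2) - (b * 0 - 0\<^sup>2 / 2))"
    by (rule nn_integral_FTC_Icc) (use assms in \<open>auto intro!: derivative_eq_intros\<close>)
  finally show ?thesis by (simp add: mult.commute)
qed

locale inverse_stable = prob_space M for M :: "'a measure" +
  fixes \<alpha> :: real and L Y :: "real \<Rightarrow> 'a \<Rightarrow> real"
  assumes \<alpha>: "0 < \<alpha>" "\<alpha> < 1"
    and L: "stable_subordinator \<alpha> L"
    and Y: "real_process Y"
    and Y_eq: "AE \<omega> in M. \<forall>t\<ge>0. Y t \<omega> = Inf {u. u > 0 \<and> L u \<omega> > t}"
begin

lemma L_levy: "levy_process L"
  and L_mono: "AE \<omega> in M. mono_on {0..} (\<lambda>t. L t \<omega>)"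
  and L_Laplace: "0 \<le> t \<Longrightarrow> 0 \<le> s \<Longrightarrow> expectation (\<lambda>\<omega>. exp (- s * L t \<omega>)) = exp (- t * s powr \<alpha>)"
  using L by (auto simp: stable_subordinator_def)

lemma L_rv[measurable]: "0 \<le> t \<Longrightarrow> random_variable borel (L t)"
  using L_levy by (rule levy_process_rv)

lemma Y_rv[measurable]: "0 \<le> t \<Longrightarrow> random_variable borel (Y t)"
  using Y by (simp add: real_process_def)

lemma L_0: "AE \<omega> in M. L 0 \<omega> = 0"
  using L_levy by (simp add: levy_process_def)

lemma L_nonneg: "AE \<omega> in M. \<forall>t\<ge>0. 0 \<le> L t \<omega>"
  using L_0 L_mono
proof eventually_elim
  case (elim \<omega>)
  show ?case
  proof (intro allI impI)
    fix t :: real assume "0 \<le> t"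
    from mono_onD[OF elim(2) _ _ this] this elim(1) show "0 \<le> L t \<omega>" by simp
  qed
qed

lemma L_nonneg_at: "0 \<le> t \<Longrightarrow> AE \<omega> in M. 0 \<le> L t \<omega>"
  using L_nonneg by auto

text \<open>
  Self-similarity of the stable subordinator, read off from its Laplace transform.
\<close>

lemma L_scaling:
  assumes "0 \<le> u" "0 < c"
  shows "distr M borel (L (c powr \<alpha> * u)) = distr M borel (\<lambda>\<omega>. c * L u \<omega>)"
proof (rule distr_eqI_Laplace)
  fix n :: nat
  have "expectation (\<lambda>\<omega>. exp (- (real n * c) * L u \<omega>)) = exp (- u * (real n * c) powr \<alpha>)"
    using assms by (intro L_Laplace) auto
  then show "expectation (\<lambda>\<omega>. exp (- real n * L (c powr \<alpha> * u) \<omega>))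
      = expectation (\<lambda>\<omega>. exp (- real n * (c * L u \<omega>)))"
    using assms by (subst L_Laplace) (auto simp: powr_mult ac_simps)
next
  show "AE \<omega> in M. 0 \<le> c * L u \<omega>"
    using L_nonneg_at[OF assms(1)] by eventually_elim (use assms(2) in simp)
qed (use assms L_nonneg_at[of "c powr \<alpha> * u"] in auto)

lemma prob_L_scaling:
  assumes "0 \<le> u" "0 < c"
  shows "prob {\<omega>\<in>space M. L (c powr \<alpha> * u) \<omega> \<le> c} = prob {\<omega>\<in>space M. L u \<omega> \<le> 1}"
  using prob_eq_if_distr_eq[OF L_scaling[OF assms], of "{..c}"] assms
  by (simp add: vimage_def Int_def conj_commute)

lemma integrable_exp_L: "0 \<le> s \<Longrightarrow> 0 \<le> u \<Longrightarrow> integrable M (\<lambda>\<omega>. exp (- s * L u \<omega>))"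
  by (rule integrable_const_bound[where B=1]) (use L_nonneg_at[of u] in auto)

text \<open>
  Markov's inequality for \<open>exp (- L u)\<close>.  The exponential decay in \<open>u\<close> yields both unbounded paths and
  finite second moments of the inverse.
\<close>

lemma prob_L_le: 
  assumes "0 \<le> u"
  shows "prob {\<omega>\<in>space M. L u \<omega> \<le> t} \<le> exp (t - u)"
proof -
  have "prob {\<omega>\<in>space M. L u \<omega> \<le> t} = expectation (indicator {\<omega>\<in>space M. L u \<omega> \<le> t})"
    using assms by simp
  also have "\<dots> \<le> expectation (\<lambda>\<omega>. exp t * exp (- 1 * L u \<omega>))"
    using assms
    by (intro integral_mono integrable_mult_right integrable_exp_L)
       (auto simp: integrable_indicator_iff emeasure_eq_measure exp_add[symmetric] split: split_indicator)
  also have "\<dots> = exp (t - u)"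
    using L_Laplace[of u 1] assms by (simp add: exp_diff exp_minus divide_inverse)
  finally show ?thesis .
qed

lemma L_unbounded: "AE \<omega> in M. \<forall>t. \<exists>u>0. L u \<omega> > t"
proof -
  have "AE \<omega> in M. \<exists>n. L (real (Suc n)) \<omega> > real m" for m
  proof (rule AE_I')
    let ?N = "{\<omega>\<in>space M. \<forall>n. L (real (Suc n)) \<omega> \<le> real m}"
    have [measurable]: "?N \<in> events" by measurable
    have "prob ?N \<le> exp (real m - real (Suc n))" for n
      by (rule order_trans[OF finite_measure_mono prob_L_le]) auto
    moreover have "(\<lambda>n. exp (real m - real (Suc n))) \<longlonglongrightarrow> 0"
      by real_asymp
    ultimately have "prob ?N \<le> 0"
      by (intro LIMSEQ_le_const) auto
    then show "?N \<in> null_sets M"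
      by (auto simp: null_sets_def emeasure_eq_measure measure_le_0_iff)
  qed (auto simp: not_less)
  then have "AE \<omega> in M. \<forall>m. \<exists>n. L (real (Suc n)) \<omega> > real m"
    by (simp add: AE_all_countable)
  then show ?thesis
  proof eventually_elim
    case (elim \<omega>)
    show ?case
    proof
      fix t
      obtain m :: nat where "t \<le> real m" using real_arch_simple by blast
      with elim obtain n where "L (real (Suc n)) \<omega> > t" by (meson le_less_trans)
      then show "\<exists>u>0. L u \<omega> > t" by (intro exI[of _ "real (Suc n)"]) simp
    qed
  qed
qed

text \<open>
  The inverse relation between the paths of \<open>L\<close> and \<open>Y\<close>.  The events \<open>u < Y t\<close> and \<open>L u \<le> t\<close> may differ
  only where \<open>Y t = u\<close>, which is negligible for almost every \<open>u\<close>.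
\<close>

lemma Y_path:
  "AE \<omega> in M. \<forall>t\<ge>0. 0 \<le> Y t \<omega> \<and> (\<forall>s. 0 \<le> s \<and> s \<le> t \<longrightarrow> Y s \<omega> \<le> Y t \<omega>) \<and>
     (\<forall>u>0. (u < Y t \<omega> \<longrightarrow> L u \<omega> \<le> t) \<and> (L u \<omega> \<le> t \<longrightarrow> u \<le> Y t \<omega>))"
  using Y_eq L_mono L_unbounded
proof eventually_elim
  case (elim \<omega>)
  let ?S = "\<lambda>t. {u. u > 0 \<and> L u \<omega> > t}"
  have bdd: "bdd_below (?S t)" for t by (rule bdd_belowI[of _ 0]) auto
  have ne: "?S t \<noteq> {}" for t using elim(3) by auto
  show ?case
  proof (intro allI impI conjI; (elim conjE)?)
    fix t :: real assume t: "0 \<le> t"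
    show "0 \<le> Y t \<omega>" using elim(1) t ne by (auto intro!: cInf_greatest)
    fix s assume s: "0 \<le> s" "s \<le> t"
    show "Y s \<omega> \<le> Y t \<omega>"
      using elim(1) s t ne bdd by (auto intro!: cInf_superset_mono)
  next
    fix t u :: real assume t: "0 \<le> t" "0 < u" "u < Y t \<omega>"
    show "L u \<omega> \<le> t"
    proof (rule ccontr)
      assume "\<not> L u \<omega> \<le> t"
      then have "Inf (?S t) \<le> u" using t bdd by (intro cInf_lower) auto
      then show False using t elim(1) by simp
    qed
  next
    fix t u :: real assume t: "0 \<le> t" "0 < u" "L u \<omega> \<le> t"
    have "u \<le> w" if "w \<in> ?S t" for w
      using mono_onD[OF elim(2), of w u] that t by (cases "u \<le> w") auto
    then have "u \<le> Inf (?S t)" using ne by (intro cInf_greatest) auto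
    then show "u \<le> Y t \<omega>" using elim(1) t by simp
  qed
qed

lemma Y_nonneg: "0 \<le> t \<Longrightarrow> AE \<omega> in M. 0 \<le> Y t \<omega>"
  using Y_path by auto

lemma Y_mono: "0 \<le> s \<Longrightarrow> s \<le> t \<Longrightarrow> AE \<omega> in M. Y s \<omega> \<le> Y t \<omega>"
  using Y_path by eventually_elim auto

lemma less_Y_iff:
  assumes "0 < u" "0 \<le> t" "AE \<omega> in M. Y t \<omega> \<noteq> u"
  shows "AE \<omega> in M. u < Y t \<omega> \<longleftrightarrow> L u \<omega> \<le> t"
  using Y_path assms(3) by eventually_elim (use assms in force)

lemma prob_less_Y:
  assumes "0 < u" "0 \<le> t" "AE \<omega> in M. Y t \<omega> \<noteq> u"
  shows "prob {\<omega>\<in>space M. u < Y t \<omega>} = prob {\<omega>\<in>space M. L u \<omega> \<le> t}"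
  by (rule finite_measure_eq_AE) (use assms less_Y_iff[OF assms] in auto)

lemma AE_prob_less_Y:
  assumes "0 \<le> t"
  shows "AE u in lborel. 0 < u \<longrightarrow> prob {\<omega>\<in>space M. u < Y t \<omega>} = prob {\<omega>\<in>space M. L u \<omega> \<le> t}"
  using AE_lborel_AE_neq[OF Y_rv[OF assms]] by eventually_elim (use prob_less_Y assms in auto)

text \<open>
  The self-similarity of \<open>L\<close> carries over to the tails of \<open>Y\<close>, and by the layer cake formula to its
  first two moments: they are multiples of \<open>t powr \<alpha>\<close> and of its square.
\<close>

lemma AE_prob_less_Y_scaled:
  assumes "0 < t"
  shows "AE u in lborel. 0 < u \<longrightarrow> prob {\<omega>\<in>space M. u < Y t \<omega>} = prob {\<omega>\<in>space M. u < t powr \<alpha> * Y 1 \<omega>}"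
proof -
  have "AE u in lborel. AE \<omega> in M. t powr \<alpha> * Y 1 \<omega> \<noteq> u"
    by (rule AE_lborel_AE_neq) measurable
  moreover have "0 \<le> t" using assms by simp
  note AE_prob_less_Y[OF this]
  ultimately show ?thesis
  proof eventually_elim
    case (elim u)
    show ?case
    proof
      assume u: "0 < u"
      \<comment> \<open>The scaled level at which the time \<open>t\<close> corresponds to the time 1.\<close>
      define w where "w = u / t powr \<alpha>"
      have w: "0 < w" "u = t powr \<alpha> * w" using u assms by (auto simp: w_def)
      have "prob {\<omega>\<in>space M. u < Y t \<omega>} = prob {\<omega>\<in>space M. L w \<omega> \<le> 1}"
        using elim u prob_L_scaling[of w t] w assms by simp
      also have "\<dots> = prob {\<omega>\<in>space M. w < Y 1 \<omega>}"
        by (rule prob_less_Y[symmetric]) (use elim(1) w assms in auto)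
      also have "\<dots> = prob {\<omega>\<in>space M. u < t powr \<alpha> * Y 1 \<omega>}"
        using w assms by simp
      finally show "prob {\<omega>\<in>space M. u < Y t \<omega>} = prob {\<omega>\<in>space M. u < t powr \<alpha> * Y 1 \<omega>}" .
    qed
  qed
qed

lemma nn_integral_Y_square: "0 \<le> t \<Longrightarrow> (\<integral>\<^sup>+\<omega>. ennreal ((Y t \<omega>)\<^sup>2) \<partial>M)
    = (\<integral>\<^sup>+u. ennreal (2 * u) * indicator {0<..} u * emeasure M {\<omega>\<in>space M. u < Y t \<omega>} \<partial>lborel)"
  using Y_nonneg[of t]
  by (subst nn_integral_tail_square[symmetric])
     (auto intro!: nn_integral_cong_AE elim!: eventually_mono)

lemma integrable_Y_square:
  assumes "0 \<le> t"
  shows "integrable M (\<lambda>\<omega>. (Y t \<omega>)\<^sup>2)"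
proof (rule integrableI_bounded)
  have "(\<integral>\<^sup>+\<omega>. ennreal (norm ((Y t \<omega>)\<^sup>2)) \<partial>M)
    = (\<integral>\<^sup>+u. ennreal (2 * u) * indicator {0<..} u * emeasure M {\<omega>\<in>space M. u < Y t \<omega>} \<partial>lborel)"
    using nn_integral_Y_square[OF assms] by simp
  also have "\<dots> \<le> (\<integral>\<^sup>+u. ennreal (2 * exp t) * (ennreal (u ^ 1 * exp (- u)) * indicator {0..} u) \<partial>lborel)"
  proof (rule nn_integral_mono_AE)
    show "AE u in lborel. ennreal (2 * u) * indicator {0<..} u * emeasure M {\<omega>\<in>space M. u < Y t \<omega>}
       \<le> ennreal (2 * exp t) * (ennreal (u ^ 1 * exp (- u)) * indicator {0..} u)"
      using AE_prob_less_Y[OF assms]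
    proof eventually_elim
      case (elim u)
      have "2 * u * prob {\<omega>\<in>space M. u < Y t \<omega>} \<le> 2 * u * exp (t - u)" if "0 < u"
        using elim that prob_L_le[of u t] by (intro mult_left_mono) auto
      then show ?case
        by (auto simp: emeasure_eq_measure ennreal_mult[symmetric] exp_diff exp_minus field_simps split: split_indicator)
    qed
  qed
  also have "\<dots> = ennreal (2 * exp t)"
    by (subst nn_integral_cmult) (simp_all add: nn_intergal_power_times_exp_Ici[of 1, simplified])
  also have "\<dots> < \<infinity>" by simp
  finally show "(\<integral>\<^sup>+\<omega>. ennreal (norm ((Y t \<omega>)\<^sup>2)) \<partial>M) < \<infinity>" .
qed (use assms in measurable)

lemma integrable_Y: "0 \<le> t \<Longrightarrow> integrable M (Y t)"
  by (rule square_integrable_imp_integrable[OF _ integrable_Y_square]) auto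

lemma integrable_Y_mult:
  assumes "0 \<le> s" "0 \<le> t"
  shows "integrable M (\<lambda>\<omega>. Y s \<omega> * Y t \<omega>)"
proof (rule Bochner_Integration.integrable_bound)
  show "integrable M (\<lambda>\<omega>. (Y s \<omega>)\<^sup>2 + (Y t \<omega>)\<^sup>2)"
    using assms by (intro Bochner_Integration.integrable_add integrable_Y_square)
  show "AE \<omega> in M. norm (Y s \<omega> * Y t \<omega>) \<le> norm ((Y s \<omega>)\<^sup>2 + (Y t \<omega>)\<^sup>2)"
  proof (rule AE_I2)
    fix \<omega>
    have "2 * (\<bar>Y s \<omega>\<bar> * \<bar>Y t \<omega>\<bar>) \<le> (Y s \<omega>)\<^sup>2 + (Y t \<omega>)\<^sup>2"
      using sum_squares_bound[of "\<bar>Y s \<omega>\<bar>" "\<bar>Y t \<omega>\<bar>"] by (simp add: mult.assoc)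
    moreover have "0 \<le> \<bar>Y s \<omega>\<bar> * \<bar>Y t \<omega>\<bar>" by simp
    ultimately have "\<bar>Y s \<omega>\<bar> * \<bar>Y t \<omega>\<bar> \<le> (Y s \<omega>)\<^sup>2 + (Y t \<omega>)\<^sup>2" by linarith
    then show "norm (Y s \<omega> * Y t \<omega>) \<le> norm ((Y s \<omega>)\<^sup>2 + (Y t \<omega>)\<^sup>2)"
      by (simp add: abs_mult)
  qed
qed (use assms in measurable)

lemma expectation_Y_nonneg: "0 \<le> t \<Longrightarrow> 0 \<le> expectation (Y t)"
  by (intro integral_nonneg_AE Y_nonneg)

lemma nn_integral_Y:
  assumes "0 \<le> t"
  shows "(\<integral>\<^sup>+\<omega>. ennreal (Y t \<omega>) \<partial>M) = ennreal (expectation (Y t))"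
  by (intro nn_integral_eq_integral integrable_Y Y_nonneg assms)

lemma expectation_Y_scaling:
  assumes "0 < t"
  shows "expectation (Y t) = t powr \<alpha> * expectation (Y 1)"
proof -
  have "ennreal (expectation (Y t)) = (\<integral>\<^sup>+\<omega>. ennreal (Y t \<omega>) \<partial>M)"
    using nn_integral_Y[of t] assms by simp
  also have "\<dots> = (\<integral>\<^sup>+\<omega>. ennreal (t powr \<alpha> * Y 1 \<omega>) \<partial>M)"
    using AE_prob_less_Y_scaled[OF assms] assms
    by (subst (1 2) nn_integral_tail)
       (auto intro!: nn_integral_cong_AE simp: emeasure_eq_measure elim!: eventually_mono split: split_indicator)
  also have "\<dots> = ennreal (t powr \<alpha>) * (\<integral>\<^sup>+\<omega>. ennreal (Y 1 \<omega>) \<partial>M)"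
    by (simp add: ennreal_mult' nn_integral_cmult)
  also have "\<dots> = ennreal (t powr \<alpha> * expectation (Y 1))"
    using nn_integral_Y[of 1] by (simp add: ennreal_mult')
  finally show ?thesis
    using expectation_Y_nonneg[of t] expectation_Y_nonneg[of 1] assms by simp
qed

lemma expectation_Y_square_scaling:
  assumes "0 < t"
  shows "expectation (\<lambda>\<omega>. (Y t \<omega>)\<^sup>2) = (t powr \<alpha>)\<^sup>2 * expectation (\<lambda>\<omega>. (Y 1 \<omega>)\<^sup>2)"
proof -
  have eq: "(\<integral>\<^sup>+\<omega>. ennreal ((Y t \<omega>)\<^sup>2) \<partial>M) = ennreal (expectation (\<lambda>\<omega>. (Y t \<omega>)\<^sup>2))" if "0 \<le> t" for t
    using that by (intro nn_integral_eq_integral integrable_Y_square) auto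
  have "ennreal (expectation (\<lambda>\<omega>. (Y t \<omega>)\<^sup>2)) = (\<integral>\<^sup>+\<omega>. ennreal ((Y t \<omega>)\<^sup>2) \<partial>M)"
    using eq[of t] assms by simp
  also have "\<dots> = (\<integral>\<^sup>+\<omega>. ennreal ((max 0 (t powr \<alpha> * Y 1 \<omega>))\<^sup>2) \<partial>M)"
    using AE_prob_less_Y_scaled[OF assms] assms
    by (subst nn_integral_Y_square, simp, subst nn_integral_tail_square)
       (auto intro!: nn_integral_cong_AE simp: emeasure_eq_measure elim!: eventually_mono split: split_indicator)
  also have "\<dots> = (\<integral>\<^sup>+\<omega>. ennreal ((t powr \<alpha>)\<^sup>2) * ennreal ((Y 1 \<omega>)\<^sup>2) \<partial>M)"
    using Y_nonneg[of 1]
    by (intro nn_integral_cong_AE)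
       (auto simp: ennreal_mult'[symmetric] power_mult_distrib elim!: eventually_mono)
  also have "\<dots> = ennreal ((t powr \<alpha>)\<^sup>2 * expectation (\<lambda>\<omega>. (Y 1 \<omega>)\<^sup>2))"
    using eq[of 1] by (simp add: ennreal_mult' nn_integral_cmult)
  finally show ?thesis
    by (simp add: integral_nonneg_AE)
qed

lemma prob_L_increment:
  assumes "0 \<le> u" "0 \<le> w"
  shows "prob {\<omega>\<in>space M. L u \<omega> \<le> s \<and> L (u + w) \<omega> - L u \<omega> \<le> x}
    = prob {\<omega>\<in>space M. L u \<omega> \<le> s} * prob {\<omega>\<in>space M. L w \<omega> \<le> x}"
proof -
  have uw: "0 \<le> u + w" "u \<le> u + w" using assms by auto
  note [measurable] = L_rv[OF assms(1)] L_rv[OF assms(2)] L_rv[OF uw(1)] L_rv[of 0, simplified]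
  have "prob {\<omega>\<in>space M. L u \<omega> \<le> s \<and> L (u + w) \<omega> - L u \<omega> \<le> x}
      = prob {\<omega>\<in>space M. L u \<omega> - L 0 \<omega> \<le> s \<and> L (u + w) \<omega> - L u \<omega> \<le> x}"
    by (rule finite_measure_eq_AE) (use L_0 in \<open>auto elim!: eventually_mono\<close>)
  also have "\<dots> = prob {\<omega>\<in>space M. L u \<omega> - L 0 \<omega> \<le> s} * prob {\<omega>\<in>space M. L (u + w) \<omega> - L u \<omega> \<le> x}"
    using indep_varD[OF levy_process_indep_increments[OF L_levy assms(1) uw(2)], of "{..s}" "{..x}"]
    by (simp add: vimage_def Int_def conj_ac)
  also have "prob {\<omega>\<in>space M. L u \<omega> - L 0 \<omega> \<le> s} = prob {\<omega>\<in>space M. L u \<omega> \<le> s}"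
    by (rule finite_measure_eq_AE) (use L_0 in \<open>auto elim!: eventually_mono\<close>)
  also have "prob {\<omega>\<in>space M. L (u + w) \<omega> - L u \<omega> \<le> x} = prob {\<omega>\<in>space M. L w \<omega> \<le> x}"
    using prob_eq_if_distr_eq[OF levy_process_increment[OF L_levy assms(1) uw(2)], of "{..x}"]
    by (simp add: vimage_def Int_def conj_commute)
  finally show ?thesis .
qed

text \<open>
  Since \<open>0 \<le> L u \<le> s\<close> on the event considered, the condition \<open>L (u + w) \<le> t\<close> lies between the conditions
  that the increment is at most \<open>t - s\<close> and that it is at most \<open>t\<close>; the increment is independent of
  \<open>L u\<close>.
\<close>

lemma prob_L_two_times:
  assumes "0 \<le> u" "0 \<le> w" "s \<le> t"
  shows "prob {\<omega>\<in>space M. L u \<omega> \<le> s} * prob {\<omega>\<in>space M. L w \<omega> \<le> t - s}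
      \<le> prob {\<omega>\<in>space M. L u \<omega> \<le> s \<and> L (u + w) \<omega> \<le> t}"
    and "prob {\<omega>\<in>space M. L u \<omega> \<le> s \<and> L (u + w) \<omega> \<le> t}
      \<le> prob {\<omega>\<in>space M. L u \<omega> \<le> s} * prob {\<omega>\<in>space M. L w \<omega> \<le> t}"
proof -
  have uw: "0 \<le> u + w" using assms by auto
  note [measurable] = L_rv[OF assms(1)] L_rv[OF uw]
  show "prob {\<omega>\<in>space M. L u \<omega> \<le> s} * prob {\<omega>\<in>space M. L w \<omega> \<le> t - s}
      \<le> prob {\<omega>\<in>space M. L u \<omega> \<le> s \<and> L (u + w) \<omega> \<le> t}"
    unfolding prob_L_increment[OF assms(1,2), symmetric]
    by (rule finite_measure_mono) auto
  show "prob {\<omega>\<in>space M. L u \<omega> \<le> s \<and> L (u + w) \<omega> \<le> t}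
      \<le> prob {\<omega>\<in>space M. L u \<omega> \<le> s} * prob {\<omega>\<in>space M. L w \<omega> \<le> t}"
    unfolding prob_L_increment[OF assms(1,2), symmetric]
    by (rule finite_measure_mono_AE) (use L_nonneg_at[OF assms(1)] in \<open>auto elim!: eventually_mono\<close>)
qed

text \<open>
  Integrating the preceding bounds over \<open>w\<close>: after the level \<open>u\<close> has been passed before time \<open>s\<close>, the
  remaining part of \<open>Y t\<close> has a mean between those of \<open>Y (t - s)\<close> and \<open>Y t\<close>.
\<close>

lemma nn_integral_residual:
  assumes "0 \<le> s" "s \<le> t" "0 < u" "AE \<omega> in M. Y s \<omega> \<noteq> u"
  defines "R \<equiv> \<integral>\<^sup>+\<omega>. ennreal (if u < Y s \<omega> then Y t \<omega> - u else 0) \<partial>M"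
  shows "emeasure M {\<omega>\<in>space M. u < Y s \<omega>} * ennreal (expectation (Y (t - s))) \<le> R"
    and "R \<le> emeasure M {\<omega>\<in>space M. u < Y s \<omega>} * ennreal (expectation (Y t))"
proof -
  have t: "0 \<le> t" "0 \<le> t - s" using assms by auto
  note [measurable] = Y_rv[OF assms(1)] Y_rv[OF t(1)] Y_rv[OF t(2)]
  define Z where "Z \<omega> = (if u < Y s \<omega> then Y t \<omega> - u else 0)" for \<omega>
  define p where "p = emeasure M {\<omega>\<in>space M. u < Y s \<omega>}"
  have [measurable]: "random_variable borel Z" unfolding Z_def by measurable
  have R: "R = (\<integral>\<^sup>+w. indicator {0<..} w * emeasure M {\<omega>\<in>space M. w < Z \<omega>} \<partial>lborel)"
    unfolding R_def Z_def[symmetric] by (rule nn_integral_tail) measurable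
  have scaled: "p * ennreal (expectation (Y r)) = (\<integral>\<^sup>+w. indicator {0<..} w * (p * emeasure M {\<omega>\<in>space M. w < Y r \<omega>}) \<partial>lborel)"
    if r: "0 \<le> r" for r
  proof -
    note [measurable] = Y_rv[OF r]
    show ?thesis
      unfolding nn_integral_Y[OF r, symmetric] nn_integral_tail[OF Y_rv[OF r]]
      by (subst nn_integral_cmult[symmetric]) (auto intro!: nn_integral_cong simp: ac_simps)
  qed
  have "AE w in lborel. AE \<omega> in M. Y t \<omega> - u \<noteq> w"
    by (rule AE_lborel_AE_neq) measurable
  then have AE: "AE w in lborel. 0 < w \<longrightarrow>
      p * emeasure M {\<omega>\<in>space M. w < Y (t - s) \<omega>} \<le> emeasure M {\<omega>\<in>space M. w < Z \<omega>} \<and>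
      emeasure M {\<omega>\<in>space M. w < Z \<omega>} \<le> p * emeasure M {\<omega>\<in>space M. w < Y t \<omega>}"
    using AE_prob_less_Y[OF t(1)] AE_prob_less_Y[OF t(2)]
  proof eventually_elim
    case (elim w)
    show ?case
    proof
      assume w: "0 < w"
      have uw: "0 \<le> u + w" "0 \<le> u" "0 < u + w" "0 \<le> w" using w assms by auto
      note [measurable] = L_rv[OF uw(1)] L_rv[OF uw(2)]
      have "AE \<omega> in M. Y t \<omega> \<noteq> u + w" using elim(1) by eventually_elim auto
      note less_Y_iff[OF uw(3) t(1) this] less_Y_iff[OF assms(3,1,4)]
      then have "prob {\<omega>\<in>space M. w < Z \<omega>} = prob {\<omega>\<in>space M. L u \<omega> \<le> s \<and> L (u + w) \<omega> \<le> t}"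
        by (intro finite_measure_eq_AE) (use w in \<open>auto simp: Z_def\<close>)
      then show "p * emeasure M {\<omega>\<in>space M. w < Y (t - s) \<omega>} \<le> emeasure M {\<omega>\<in>space M. w < Z \<omega>} \<and>
          emeasure M {\<omega>\<in>space M. w < Z \<omega>} \<le> p * emeasure M {\<omega>\<in>space M. w < Y t \<omega>}"
        using prob_L_two_times[OF uw(2,4) assms(2)] prob_less_Y[OF assms(3,1,4)] elim w
        by (simp add: p_def emeasure_eq_measure ennreal_mult[symmetric])
    qed
  qed
  show "emeasure M {\<omega>\<in>space M. u < Y s \<omega>} * ennreal (expectation (Y (t - s))) \<le> R"
    unfolding p_def[symmetric] scaled[OF t(2)] R
    by (rule nn_integral_mono_AE) (use AE in \<open>auto elim!: eventually_mono split: split_indicator\<close>)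
  show "R \<le> emeasure M {\<omega>\<in>space M. u < Y s \<omega>} * ennreal (expectation (Y t))"
    unfolding p_def[symmetric] scaled[OF t(1)] R
    by (rule nn_integral_mono_AE) (use AE in \<open>auto elim!: eventually_mono split: split_indicator\<close>)
qed

text \<open>
  The product \<open>Y s * Y t\<close> is the area of a rectangle.  The part below the diagonal contributes
  \<open>(Y s)\<^sup>2 / 2\<close>, and the part above it is the integral over \<open>u < Y s\<close> of the residual \<open>Y t - u\<close>, whose
  mean has just been estimated.  The two bounds differ only by replacing \<open>t\<close> by \<open>t - s\<close> in a mean.
\<close>

lemma expectation_Y_mult_bounds:
  assumes s: "0 \<le> s" "s \<le> t"
  defines "r \<equiv> expectation (\<lambda>\<omega>. Y s \<omega> * Y t \<omega>) - expectation (\<lambda>\<omega>. (Y s \<omega>)\<^sup>2) / 2"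
  shows "expectation (Y s) * expectation (Y (t - s)) \<le> r"
    and "r \<le> expectation (Y s) * expectation (Y t)"
proof -
  have t: "0 \<le> t" "0 \<le> t - s" using s by auto
  interpret P: pair_sigma_finite M "lborel :: real measure" ..
  note [measurable] = Y_rv[OF s(1)] Y_rv[OF t(1)] Y_rv[OF t(2)]
  define R where "R u = (\<integral>\<^sup>+\<omega>. ennreal (if u < Y s \<omega> then Y t \<omega> - u else 0) \<partial>M)" for u
  define p where "p u = emeasure M {\<omega>\<in>space M. u < Y s \<omega>}" for u
  have [measurable]: "p \<in> borel_measurable lborel"
    unfolding p_def by measurable
  have nonneg: "AE \<omega> in M. 0 \<le> Y s \<omega> * Y t \<omega> - (Y s \<omega>)\<^sup>2 / 2"
    using Y_mono[OF s] Y_nonneg[OF s(1)]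
  proof eventually_elim
    case (elim \<omega>)
    have "Y s \<omega> * Y s \<omega> \<le> Y s \<omega> * Y t \<omega>" using elim by (intro mult_left_mono)
    moreover have "0 \<le> Y s \<omega> * Y s \<omega>" by simp
    ultimately show ?case unfolding power2_eq_square by linarith
  qed
  have int: "integrable M (\<lambda>\<omega>. Y s \<omega> * Y t \<omega> - (Y s \<omega>)\<^sup>2 / 2)"
    using s t by (intro Bochner_Integration.integrable_diff integrable_Y_mult integrable_divide integrable_Y_square)
  have r: "r = expectation (\<lambda>\<omega>. Y s \<omega> * Y t \<omega> - (Y s \<omega>)\<^sup>2 / 2)"
    unfolding r_def using s t by (simp add: integrable_Y_mult integrable_Y_square)
  then have r0: "0 \<le> r" using nonneg by (simp add: integral_nonneg_AE)
  have "ennreal r = (\<integral>\<^sup>+\<omega>. ennreal (Y s \<omega> * Y t \<omega> - (Y s \<omega>)\<^sup>2 / 2) \<partial>M)"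
    unfolding r by (rule nn_integral_eq_integral[symmetric, OF int nonneg])
  also have "\<dots> = (\<integral>\<^sup>+\<omega>. \<integral>\<^sup>+u. ennreal (Y t \<omega> - u) * indicator {0<..<Y s \<omega>} u \<partial>lborel \<partial>M)"
    using Y_mono[OF s] Y_nonneg[OF s(1)]
    by (intro nn_integral_cong_AE) (auto simp: nn_integral_trapezoid elim!: eventually_elim2)
  also have "\<dots> = (\<integral>\<^sup>+\<omega>. \<integral>\<^sup>+u. indicator {0<..} u * ennreal (if u < Y s \<omega> then Y t \<omega> - u else 0) \<partial>lborel \<partial>M)"
    by (intro nn_integral_cong) (auto split: split_indicator)
  also have "\<dots> = (\<integral>\<^sup>+u. \<integral>\<^sup>+\<omega>. indicator {0<..} u * ennreal (if u < Y s \<omega> then Y t \<omega> - u else 0) \<partial>M \<partial>lborel)"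
    by (rule P.Fubini'[symmetric]) measurable
  also have "\<dots> = (\<integral>\<^sup>+u. indicator {0<..} u * R u \<partial>lborel)"
    unfolding R_def by (intro nn_integral_cong nn_integral_cmult) measurable
  finally have rR: "ennreal r = (\<integral>\<^sup>+u. indicator {0<..} u * R u \<partial>lborel)" .
  have prod: "ennreal (expectation (Y s) * expectation (Y x))
      = (\<integral>\<^sup>+u. indicator {0<..} u * (p u * ennreal (expectation (Y x))) \<partial>lborel)" if "0 \<le> x" for x
  proof -
    have "ennreal (expectation (Y s) * expectation (Y x)) = (\<integral>\<^sup>+u. indicator {0<..} u * p u \<partial>lborel) * ennreal (expectation (Y x))"
      using nn_integral_Y[OF s(1)] nn_integral_tail[OF Y_rv[OF s(1)]] expectation_Y_nonneg[OF s(1)] 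
        expectation_Y_nonneg[OF that]
      by (simp add: p_def ennreal_mult)
    also have "\<dots> = (\<integral>\<^sup>+u. indicator {0<..} u * (p u * ennreal (expectation (Y x))) \<partial>lborel)"
      by (subst nn_integral_multc[symmetric]) (auto simp: ac_simps)
    finally show ?thesis .
  qed
  note neq = AE_lborel_AE_neq[OF Y_rv[OF s(1)]]
  have "ennreal (expectation (Y s) * expectation (Y (t - s))) \<le> ennreal r"
    unfolding rR prod[OF t(2)]
  proof (rule nn_integral_mono_AE)
    show "AE u in lborel. indicator {0<..} u * (p u * ennreal (expectation (Y (t - s)))) \<le> indicator {0<..} u * R u"
      using neq by eventually_elim
        (use nn_integral_residual(1)[OF s] in \<open>auto simp: p_def R_def split: split_indicator\<close>)
  qed
  then show "expectation (Y s) * expectation (Y (t - s)) \<le> r"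
    using r0 by (simp add: ennreal_le_iff)
  have "ennreal r \<le> ennreal (expectation (Y s) * expectation (Y t))"
    unfolding rR prod[OF t(1)]
  proof (rule nn_integral_mono_AE)
    show "AE u in lborel. indicator {0<..} u * R u \<le> indicator {0<..} u * (p u * ennreal (expectation (Y t)))"
      using neq by eventually_elim
        (use nn_integral_residual(2)[OF s] in \<open>auto simp: p_def R_def split: split_indicator\<close>)
  qed
  then show "r \<le> expectation (Y s) * expectation (Y t)"
    using expectation_Y_nonneg[OF s(1)] expectation_Y_nonneg[OF t(1)] by (simp add: ennreal_le_iff)
qed

text \<open>
  The bounds enclose the covariance within \<open>E (Y s) * (E (Y t) - E (Y (t - s)))\<close>, and
  \<open>t powr \<alpha> - (t - s) powr \<alpha>\<close> vanishes at infinity because \<open>\<alpha> < 1\<close>.  The covariance neither vanishes nor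
  grows: this is the source of the long memory.
\<close>

lemma Y_covariance_tendsto:
  assumes "0 < s"
  shows "((\<lambda>t. expectation (\<lambda>\<omega>. Y s \<omega> * Y t \<omega>) - expectation (Y s) * expectation (Y t))
    \<longlongrightarrow> expectation (\<lambda>\<omega>. (Y s \<omega>)\<^sup>2) / 2) at_top"
proof (rule tendsto_sandwich)
  let ?c = "expectation (\<lambda>\<omega>. (Y s \<omega>)\<^sup>2) / 2"
  let ?d = "\<lambda>t. expectation (Y s) * expectation (Y 1) * (t powr \<alpha> - (t - s) powr \<alpha>)"
  have large: "\<forall>\<^sub>F t in at_top. s < t" by (rule eventually_gt_at_top)
  then show "\<forall>\<^sub>F t in at_top. ?c - ?d t \<le> expectation (\<lambda>\<omega>. Y s \<omega> * Y t \<omega>) - expectation (Y s) * expectation (Y t)"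
  proof eventually_elim
    case (elim t)
    then show ?case
      using expectation_Y_mult_bounds(1)[of s t] expectation_Y_scaling[of t] expectation_Y_scaling[of "t - s"] assms
      by (simp add: algebra_simps)
  qed
  show "\<forall>\<^sub>F t in at_top. expectation (\<lambda>\<omega>. Y s \<omega> * Y t \<omega>) - expectation (Y s) * expectation (Y t) \<le> ?c"
    using large
  proof eventually_elim
    case (elim t)
    then show ?case
      using expectation_Y_mult_bounds(2)[of s t] assms by simp
  qed
  have "((\<lambda>t. t powr \<alpha> - (t - s) powr \<alpha>) \<longlongrightarrow> 0) at_top"
    using \<alpha> assms by real_asymp
  then have "((\<lambda>t. ?c - ?d t) \<longlongrightarrow> ?c - expectation (Y s) * expectation (Y 1) * 0) at_top"
    by (intro tendsto_intros)
  then show "((\<lambda>t. ?c - ?d t) \<longlongrightarrow> ?c) at_top" by simp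
qed simp

text \<open>
  If \<open>Y 1\<close> were a constant \<open>c\<close>, then \<open>L u\<close> would be at most 1 for \<open>u < c\<close> and larger than 1 for
  \<open>u > c\<close>.  The former is incompatible with \<open>exp (- u * s powr \<alpha>)\<close> for small \<open>s\<close>, where \<open>s powr \<alpha>\<close> is
  much larger than \<open>s\<close>; the latter, when \<open>c = 0\<close>, is incompatible with this transform for small \<open>u\<close>.
\<close>

lemma variance_Y_pos: "0 < variance (Y 1)"
proof (rule ccontr)
  assume "\<not> 0 < variance (Y 1)"
  then have "variance (Y 1) = 0" using variance_positive[of "Y 1"] by linarith
  define c where "c = expectation (Y 1)"
  have "integrable M (\<lambda>\<omega>. (Y 1 \<omega> - c)\<^sup>2)"
    using integrable_Y[of 1] integrable_Y_square[of 1] by (simp add: power2_diff)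
  with \<open>variance (Y 1) = 0\<close> have "AE \<omega> in M. (Y 1 \<omega> - c)\<^sup>2 = 0"
    by (subst integral_nonneg_eq_0_iff_AE[symmetric]) (auto simp: c_def)
  then have const: "AE \<omega> in M. Y 1 \<omega> = c" by eventually_elim simp
  have "0 \<le> c" unfolding c_def by (rule expectation_Y_nonneg) simp
  have path: "AE \<omega> in M. \<forall>u>0. (u < c \<longrightarrow> L u \<omega> \<le> 1) \<and> (L u \<omega> \<le> 1 \<longrightarrow> u \<le> c)"
    using const Y_path by eventually_elim auto
  show False
  proof (cases "c = 0")
    case True
    \<comment> \<open>At \<open>u = 1/2\<close> the transform equals \<open>exp (- 1/2)\<close>, which exceeds \<open>exp (- 1)\<close>.\<close>
    have "expectation (\<lambda>\<omega>. exp (- 1 * L (1 / 2) \<omega>)) \<le> exp (- 1)"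
    proof (rule integral_le_const)
      show "AE \<omega> in M. exp (- 1 * L (1 / 2) \<omega>) \<le> exp (- 1)"
        using path
      proof eventually_elim
        case (elim \<omega>)
        from elim[rule_format, of "1 / 2"] True show ?case by auto
      qed
    qed (rule integrable_exp_L, simp_all)
    then show False
      using L_Laplace[of "1 / 2" 1] by simp
  next
    case False
    define u where "u = c / 2"
    \<comment> \<open>This choice makes \<open>s = s powr \<alpha> * u / 2\<close>, so that the transform bound \<open>u * s powr \<alpha> \<le> s\<close> fails.\<close>
    define s where "s = (u / 2) powr (1 / (1 - \<alpha>))"
    have u: "0 < u" "u < c" using False \<open>0 \<le> c\<close> by (auto simp: u_def)
    then have s: "0 < s" by (simp add: s_def)
    have "exp (- s) \<le> expectation (\<lambda>\<omega>. exp (- s * L u \<omega>))"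
    proof (rule integral_ge_const)
      show "AE \<omega> in M. exp (- s) \<le> exp (- s * L u \<omega>)"
        using path
      proof eventually_elim
        case (elim \<omega>)
        from elim[rule_format, of u] u have "L u \<omega> \<le> 1" by auto
        then show ?case using s by simp
      qed
    qed (rule integrable_exp_L, use u s in simp_all)
    then have "u * s powr \<alpha> \<le> s"
      using L_Laplace[of u s] u s by simp
    moreover have "s = s powr \<alpha> * s powr (1 - \<alpha>)"
      using s by (simp add: powr_add[symmetric])
    moreover have "s powr (1 - \<alpha>) = u / 2"
      using u \<alpha> by (simp add: s_def powr_powr)
    ultimately have "s powr \<alpha> * u \<le> s powr \<alpha> * (u / 2)" by (simp add: mult.commute)
    then show False using s u by (simp add: mult_le_cancel_left_pos)
  qed
qed

lemma expectation_Y_pos: 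
  assumes "0 < t"
  shows "0 < expectation (Y t)"
proof -
  have "expectation (Y 1) \<noteq> 0"
  proof
    assume *: "expectation (Y 1) = 0"
    then have "AE \<omega> in M. Y 1 \<omega> = 0"
      using Y_nonneg[of 1] integrable_Y[of 1] by (subst integral_nonneg_eq_0_iff_AE[symmetric]) auto
    then have "expectation (\<lambda>\<omega>. (Y 1 \<omega>)\<^sup>2) = 0"
      by (intro integral_eq_zero_AE) auto
    then show False
      using variance_Y_pos * by simp
  qed
  then show ?thesis
    using expectation_Y_nonneg[of 1] expectation_Y_scaling[OF assms] assms by simp
qed

end

section \<open>Poisson processes and truncated geometric jumps\<close>

text \<open>
  Stationary increments give monotonicity of a Poisson process only at countably many pairs of
  times simultaneously; right continuity extends it to all pairs.
\<close>

lemma mono_on_if_right_continuous: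
  fixes f :: "real \<Rightarrow> real"
  assumes cont: "\<And>t. 0 \<le> t \<Longrightarrow> (f \<longlongrightarrow> f t) (at_right t)"
    and rat: "\<And>p q. p \<in> \<rat> \<Longrightarrow> q \<in> \<rat> \<Longrightarrow> 0 \<le> p \<Longrightarrow> p \<le> q \<Longrightarrow> f p \<le> f q"
  shows "mono_on {0..} f"
proof (rule mono_onI)
  fix a b :: real assume ab: "a \<in> {0..}" "b \<in> {0..}" "a \<le> b"
  have approx: "\<exists>p\<in>\<rat>. t < p \<and> p < t' \<and> \<bar>f p - f t\<bar> < e" if t: "0 \<le> t" "t < t'" and e: "0 < e" for t t' e
  proof -
    have "\<forall>\<^sub>F x in at_right t. dist (f x) (f t) < e"
      using tendstoD[OF cont[OF t(1)] e] .
    then obtain c where c: "t < c" "\<And>y. t < y \<Longrightarrow> y < c \<Longrightarrow> dist (f y) (f t) < e"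
      by (auto simp: eventually_at_right_field)
    obtain p where "p \<in> \<rat>" "t < p" "p < min c t'"
      using Rats_dense_in_real[of t "min c t'"] c(1) t by auto
    then show ?thesis using c(2) by (auto simp: dist_real_def)
  qed
  show "f a \<le> f b"
  proof (cases "a = b")
    case False
    show ?thesis
    proof (rule field_le_epsilon)
      fix e :: real assume "0 < e"
      then obtain p q where pq: "p \<in> \<rat>" "q \<in> \<rat>" "a < p" "p < b" "b < q" "\<bar>f p - f a\<bar> < e / 2" "\<bar>f q - f b\<bar> < e / 2"
        using approx[of a b "e / 2"] approx[of b "b + 1" "e / 2"] ab False by auto
      then have "f p \<le> f q" using rat[of p q] ab by auto
      then show "f a \<le> f b + e" using pq(6,7) by linarith
    qed
  qed simp
qed

context prob_space
begin

lemma has_bochner_integral_nat_valued: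
  fixes f :: "nat \<Rightarrow> real"
  assumes [measurable]: "K \<in> measurable M (count_space UNIV)" and f: "\<And>n. 0 \<le> f n"
    and sums: "(\<lambda>n. f n * prob {\<omega>\<in>space M. K \<omega> = n}) sums c"
  shows "has_bochner_integral M (\<lambda>\<omega>. f (K \<omega>)) c"
proof (rule has_bochner_integral_nn_integral)
  show "0 \<le> c" using sums f by (auto simp: sums_iff intro!: suminf_nonneg)
  have "(\<integral>\<^sup>+\<omega>. ennreal (f (K \<omega>)) \<partial>M) = (\<Sum>n. \<integral>\<^sup>+\<omega>. indicator {\<omega>\<in>space M. K \<omega> = n} \<omega> * ennreal (f n) \<partial>M)"
    by (rule nn_integral_nat_valued) measurable
  also have "\<dots> = (\<Sum>n. ennreal (f n * prob {\<omega>\<in>space M. K \<omega> = n}))"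
    by (intro suminf_cong)
       (subst nn_integral_multc, auto simp: emeasure_eq_measure ennreal_mult[symmetric] f mult.commute)
  also have "\<dots> = ennreal c"
    using sums f by (subst suminf_ennreal2) (auto simp: sums_iff)
  finally show "(\<integral>\<^sup>+\<omega>. ennreal (f (K \<omega>)) \<partial>M) = ennreal c" .
qed (use f in auto)

lemma measurable_vimage_algebra_component:
  assumes "i \<in> I"
  shows "X i \<in> measurable (vimage_algebra (space M) (\<lambda>\<omega>. \<lambda>i\<in>I. X i \<omega>) (\<Pi>\<^sub>M i\<in>I. borel)) borel"
proof -
  have "(\<lambda>\<omega>. \<lambda>i\<in>I. X i \<omega>) \<in> measurable (vimage_algebra (space M) (\<lambda>\<omega>. \<lambda>i\<in>I. X i \<omega>) (\<Pi>\<^sub>M i\<in>I. borel))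
      (\<Pi>\<^sub>M i\<in>I. borel)"
    by (rule measurable_vimage_algebra1) (auto simp: space_PiM)
  from measurable_compose[OF this measurable_component_singleton[OF assms]] show ?thesis
    using assms by simp
qed

text \<open>
  The sigma-algebras generated by the two families matter only through their independence and the
  measurability of the members, which is the shape consumed by \<open>nn_integral_indep_index\<close>.
\<close>

lemma indep_familiesE:
  assumes "indep_families I X J Z"
  obtains F G where "indep_set (sets F) (sets G)" "space F = space M" "space G = space M"
    "\<And>i. i \<in> I \<Longrightarrow> X i \<in> measurable F borel" "\<And>j. j \<in> J \<Longrightarrow> Z j \<in> measurable G borel"
  by (rule that[OF assms[unfolded indep_families_def generated_events_def] _ _
        measurable_vimage_algebra_component measurable_vimage_algebra_component]) simp_all

lemma poisson_process_rv:
  assumes "poisson_process lam N1" "0 \<le> t"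
  shows "N1 t \<in> measurable M (count_space UNIV)"
proof -
  have [measurable]: "random_variable borel (\<lambda>\<omega>. real (N1 t \<omega>))"
    using levy_process_rv[of "\<lambda>t \<omega>. real (N1 t \<omega>)"] assms by (simp add: poisson_process_def)
  have "N1 t -` {n} \<inter> space M \<in> events" for n
  proof -
    have "N1 t -` {n} \<inter> space M = {\<omega>\<in>space M. real (N1 t \<omega>) = real n}" by auto
    also have "\<dots> \<in> events" by measurable
    finally show ?thesis .
  qed
  then show ?thesis
    by (auto simp: measurable_count_space_eq2_countable)
qed

lemma poisson_process_moments:
  assumes P: "poisson_process lam N1" and t: "0 \<le> t"
  shows "has_bochner_integral M (\<lambda>\<omega>. real (N1 t \<omega>)) (lam * t)"
    and "has_bochner_integral M (\<lambda>\<omega>. (real (N1 t \<omega>))\<^sup>2) (lam * t + (lam * t)\<^sup>2)"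
proof -
  define x where "x = lam * t"
  have prob: "prob {\<omega>\<in>space M. N1 t \<omega> = n} = exp (- x) * (x ^ n / fact n)" for n
    using P t by (simp add: poisson_process_def x_def)
  have e: "(\<lambda>n. x ^ n / fact n) sums exp x"
    using exp_converges[of x] by (simp add: divide_inverse mult.commute)
  have shift: "real (Suc n) * (x ^ Suc n / fact (Suc n)) = x * (x ^ n / fact n)" for n
    by (simp del: of_nat_Suc)
  with sums_mult[OF e, of x]
  have m1: "(\<lambda>n. real n * (x ^ n / fact n)) sums (x * exp x)"
    using sums_Suc_iff[of "\<lambda>n. real n * (x ^ n / fact n)" "x * exp x"] by simp
  have "(real (Suc n))\<^sup>2 * (x ^ Suc n / fact (Suc n)) = x * (real n * (x ^ n / fact n) + x ^ n / fact n)" for n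
    unfolding power2_eq_square mult.assoc shift by (simp add: algebra_simps add_divide_distrib)
  with sums_mult[OF sums_add[OF m1 e], of x]
  have m2: "(\<lambda>n. (real n)\<^sup>2 * (x ^ n / fact n)) sums (x * (x * exp x + exp x))"
    using sums_Suc_iff[of "\<lambda>n. (real n)\<^sup>2 * (x ^ n / fact n)" "x * (x * exp x + exp x)"] by simp
  have "x * exp x * exp (- x) = x" "x * (x * exp x + exp x) * exp (- x) = x + x\<^sup>2"
    by (simp_all add: algebra_simps exp_add[symmetric] power2_eq_square flip: exp_minus_inverse)
  with sums_mult2[OF m1, of "exp (- x)"] sums_mult2[OF m2, of "exp (- x)"]
  show "has_bochner_integral M (\<lambda>\<omega>. real (N1 t \<omega>)) (lam * t)"
    "has_bochner_integral M (\<lambda>\<omega>. (real (N1 t \<omega>))\<^sup>2) (lam * t + (lam * t)\<^sup>2)"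
    by (auto intro!: has_bochner_integral_nat_valued[where K="N1 t"] poisson_process_rv[OF P t]
        simp: prob x_def[symmetric] ac_simps)
qed

text \<open>
  The value at the later time is the value at \<open>a\<close> plus an increment independent of it.  The value at
  time 0 vanishes only almost surely, so it is carried along in the first increment and removed
  afterwards.
\<close>

lemma poisson_process_product_moment:
  assumes P: "poisson_process lam N1" and ab: "0 \<le> a" "a \<le> b"
  shows "has_bochner_integral M (\<lambda>\<omega>. real (N1 a \<omega>) * real (N1 b \<omega>)) (lam * a + lam\<^sup>2 * a * b)"
proof -
  have L: "levy_process (\<lambda>t \<omega>. real (N1 t \<omega>))" using P by (simp add: poisson_process_def)
  have b: "0 \<le> b" using ab by simp
  note [measurable] = poisson_process_rv[OF P ab(1)] poisson_process_rv[OF P b]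
    poisson_process_rv[OF P order_refl]
  have zero: "AE \<omega> in M. real (N1 0 \<omega>) = 0" using L by (simp add: levy_process_def)
  note ma = poisson_process_moments[OF P ab(1)] and mb = poisson_process_moments[OF P b]
  have inta: "has_bochner_integral M (\<lambda>\<omega>. real (N1 a \<omega>) - real (N1 0 \<omega>)) (lam * a)"
    using ma(1) zero
    by (subst has_bochner_integral_cong_AE[where g="\<lambda>\<omega>. real (N1 a \<omega>)"]) (auto elim!: eventually_mono)
  have intd: "has_bochner_integral M (\<lambda>\<omega>. real (N1 b \<omega>) - real (N1 a \<omega>)) (lam * b - lam * a)"
    by (rule has_bochner_integral_diff[OF mb(1) ma(1)])
  note ind = levy_process_indep_increments[OF L ab]
  have "has_bochner_integral M (\<lambda>\<omega>. (real (N1 a \<omega>) - real (N1 0 \<omega>)) * (real (N1 b \<omega>) - real (N1 a \<omega>)))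
      ((lam * a) * (lam * b - lam * a))"
    using indep_var_lebesgue_integral[OF ind] indep_var_integrable[OF ind] inta intd
    by (simp add: has_bochner_integral_iff)
  then have "has_bochner_integral M (\<lambda>\<omega>. real (N1 a \<omega>) * (real (N1 b \<omega>) - real (N1 a \<omega>)))
      ((lam * a) * (lam * b - lam * a))"
    using zero
    by (subst has_bochner_integral_cong_AE[where g="\<lambda>\<omega>. (real (N1 a \<omega>) - real (N1 0 \<omega>)) * (real (N1 b \<omega>) - real (N1 a \<omega>))"])
       (auto elim!: eventually_mono)
  from has_bochner_integral_add[OF this ma(2)] show ?thesis
    by (simp add: algebra_simps power2_eq_square)
qed

lemma poisson_process_mono:
  assumes P: "poisson_process lam N1"
  shows "AE \<omega> in M. mono_on {0..} (\<lambda>t. real (N1 t \<omega>))"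
proof -
  have L: "levy_process (\<lambda>t \<omega>. real (N1 t \<omega>))" using P by (simp add: poisson_process_def)
  have le: "AE \<omega> in M. real (N1 p \<omega>) \<le> real (N1 q \<omega>)" if pq: "0 \<le> p" "p \<le> q" for p q
  proof -
    have q: "0 \<le> q" "0 \<le> q - p" using pq by auto
    note [measurable] = poisson_process_rv[OF P pq(1)] poisson_process_rv[OF P q(1)] poisson_process_rv[OF P q(2)]
    have "prob {\<omega>\<in>space M. real (N1 q \<omega>) - real (N1 p \<omega>) < 0} = prob {\<omega>\<in>space M. real (N1 (q - p) \<omega>) < 0}"
      using prob_eq_if_distr_eq[OF levy_process_increment[OF L pq], of "{..<0}"]
      by (simp add: vimage_def Int_def conj_commute)
    moreover have "{\<omega>\<in>space M. real (N1 q \<omega>) - real (N1 p \<omega>) < 0} \<in> events" by measurable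
    ultimately have "{\<omega>\<in>space M. real (N1 q \<omega>) - real (N1 p \<omega>) < 0} \<in> null_sets M"
      by (simp add: null_sets_def emeasure_eq_measure)
    then show ?thesis by (rule AE_I') (auto simp: not_le)
  qed
  have "AE \<omega> in M. \<forall>p\<in>\<rat>. \<forall>q\<in>\<rat>. 0 \<le> p \<longrightarrow> p \<le> q \<longrightarrow> real (N1 p \<omega>) \<le> real (N1 q \<omega>)"
    using le by (auto simp: AE_ball_countable countable_rat)
  moreover have "AE \<omega> in M. cadlag (\<lambda>t. real (N1 t \<omega>))" using L by (simp add: levy_process_def)
  ultimately show ?thesis
    by eventually_elim (rule mono_on_if_right_continuous, auto simp: cadlag_def)
qed

end

text \<open>
  The mass function is extended by 0, which turns moments into finite sums.
\<close>

definition tgeom_pmf :: "nat \<Rightarrow> real \<Rightarrow> nat \<Rightarrow> real" where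
  "tgeom_pmf k \<rho> m = (if m \<in> {1..k} then (1 - \<rho>) / (1 - \<rho> ^ k) * \<rho> ^ (m - 1) else 0)"

definition tgeom_moment :: "nat \<Rightarrow> real \<Rightarrow> nat \<Rightarrow> real" where
  "tgeom_moment k \<rho> r = (\<Sum>m=1..k. real m ^ r * tgeom_pmf k \<rho> m)"

lemma sum_tgeom_pmf:
  assumes "1 \<le> k" "0 \<le> \<rho>" "\<rho> < 1"
  shows "(\<Sum>m=1..k. tgeom_pmf k \<rho> m) = 1"
proof -
  have "\<rho> ^ k < 1" using assms by (simp add: power_less_one_iff)
  have "(\<Sum>m=1..k. tgeom_pmf k \<rho> m) = (\<Sum>i<k. (1 - \<rho>) / (1 - \<rho> ^ k) * \<rho> ^ i)"
    by (rule sum.reindex_bij_witness[of _ Suc "\<lambda>m. m - 1"]) (auto simp: tgeom_pmf_def)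
  also have "\<dots> = (1 - \<rho>) * (\<Sum>i<k. \<rho> ^ i) / (1 - \<rho> ^ k)"
    by (simp add: sum_distrib_left sum_divide_distrib)
  also have "\<dots> = 1"
    unfolding one_diff_power_eq[symmetric] using \<open>\<rho> ^ k < 1\<close> by simp
  finally show ?thesis .
qed

lemma tgeom_pmf_nonneg: "0 \<le> \<rho> \<Longrightarrow> \<rho> < 1 \<Longrightarrow> 0 \<le> tgeom_pmf k \<rho> m"
  by (auto simp: tgeom_pmf_def power_le_one intro!: mult_nonneg_nonneg divide_nonneg_nonneg)

lemma truncated_geometric_moment_ge_1:
  assumes "1 \<le> k" "0 \<le> \<rho>" "\<rho> < 1"
  shows "1 \<le> tgeom_moment k \<rho> r"
proof -
  have "(\<Sum>m=1..k. tgeom_pmf k \<rho> m) \<le> (\<Sum>m=1..k. real m ^ r * tgeom_pmf k \<rho> m)"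
  proof (rule sum_mono)
    fix m assume "m \<in> {1..k}"
    then have "1 * tgeom_pmf k \<rho> m \<le> real m ^ r * tgeom_pmf k \<rho> m"
      using assms by (intro mult_right_mono tgeom_pmf_nonneg) auto
    then show "tgeom_pmf k \<rho> m \<le> real m ^ r * tgeom_pmf k \<rho> m" by simp
  qed
  then show ?thesis using sum_tgeom_pmf[OF assms] by (simp add: tgeom_moment_def)
qed

context prob_space
begin

lemma prob_truncated_geometric:
  assumes k: "1 \<le> k" "0 \<le> \<rho>" "\<rho> < 1" and X: "truncated_geometric k \<rho> X"
  shows "prob {\<omega>\<in>space M. X \<omega> = m} = tgeom_pmf k \<rho> m"
proof -
  have [measurable]: "X \<in> measurable M (count_space UNIV)" 
    and p: "\<And>m. m \<in> {1..k} \<Longrightarrow> prob {\<omega>\<in>space M. X \<omega> = m} = tgeom_pmf k \<rho> m"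
    using X by (auto simp: truncated_geometric_def tgeom_pmf_def)
  have "prob {\<omega>\<in>space M. X \<omega> = m} = 0" if m: "m \<notin> {1..k}"
  proof -
    \<comment> \<open>The masses on \<open>{1..k}\<close> already add up to 1, so nothing is left for \<open>m\<close>.\<close>
    have "(\<Sum>j\<in>insert m {1..k}. prob {\<omega>\<in>space M. X \<omega> = j}) = prob (\<Union>j\<in>insert m {1..k}. {\<omega>\<in>space M. X \<omega> = j})"
      by (rule finite_measure_finite_Union[symmetric]) (auto simp: disjoint_family_on_def)
    also have "\<dots> \<le> 1" by simp
    finally show ?thesis
      using m sum_tgeom_pmf[OF k] p by (simp add: measure_le_0_iff)
  qed
  then show ?thesis using p by (cases "m \<in> {1..k}") (auto simp: tgeom_pmf_def)
qed

lemma truncated_geometric_moment: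
  assumes k: "1 \<le> k" "0 \<le> \<rho>" "\<rho> < 1" and X: "truncated_geometric k \<rho> X"
  shows "has_bochner_integral M (\<lambda>\<omega>. real (X \<omega>) ^ r) (tgeom_moment k \<rho> r)"
proof (rule has_bochner_integral_nat_valued)
  show "X \<in> measurable M (count_space UNIV)" using X by (simp add: truncated_geometric_def)
  show "(\<lambda>n. real n ^ r * prob {\<omega>\<in>space M. X \<omega> = n}) sums tgeom_moment k \<rho> r"
    unfolding tgeom_moment_def prob_truncated_geometric[OF k X]
    by (rule sums_finite) (auto simp: tgeom_pmf_def)
qed simp

end

section \<open>Moments of the Polya-Aeppli process\<close>

locale polya_aeppli = prob_space M for M :: "'a measure" +
  fixes k :: nat and lam \<rho> :: real and N :: "real \<Rightarrow> 'a \<Rightarrow> real"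
    and N1 :: "real \<Rightarrow> 'a \<Rightarrow> nat" and X :: "nat \<Rightarrow> 'a \<Rightarrow> nat"
  assumes par: "1 \<le> k" "0 \<le> \<rho>" "\<rho> < 1" "0 < lam"
    and N: "real_process N"
    and N1: "poisson_process lam N1"
    and X: "\<And>i. 1 \<le> i \<Longrightarrow> truncated_geometric k \<rho> (X i)"
    and X_indep: "indep_vars (\<lambda>_. count_space UNIV) X {1..}"
    and N1_X: "indep_families {0..} N1 {1..} X"
    and N_eq: "AE \<omega> in M. \<forall>t\<ge>0. N t \<omega> = real (\<Sum>i=1..N1 t \<omega>. X i \<omega>)"
begin

abbreviation "m1 \<equiv> tgeom_moment k \<rho> 1"
abbreviation "m2 \<equiv> tgeom_moment k \<rho> 2"

definition S :: "nat \<Rightarrow> 'a \<Rightarrow> real" where "S n \<omega> = (\<Sum>i=1..n. real (X i \<omega>))"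

lemma N_rv: "0 \<le> t \<Longrightarrow> random_variable borel (N t)"
  using N by (simp add: real_process_def)

lemma S_nonneg: "0 \<le> S n \<omega>"
  by (simp add: S_def sum_nonneg)

lemma S_mono: "m \<le> n \<Longrightarrow> S m \<omega> \<le> S n \<omega>"
  unfolding S_def by (rule sum_mono2) auto

lemma N_eq_S: "AE \<omega> in M. \<forall>t\<ge>0. N t \<omega> = S (N1 t \<omega>) \<omega>"
  using N_eq by eventually_elim (simp add: S_def)

lemma N_path: "AE \<omega> in M. mono_on {0..} (\<lambda>t. N t \<omega>) \<and> (\<forall>t\<ge>0. 0 \<le> N t \<omega>)"
  using N_eq_S poisson_process_mono[OF N1]
  by eventually_elim (auto simp: mono_on_def S_nonneg intro!: S_mono)

text \<open>
  The variance of a jump is nonnegative.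
\<close>

lemma m2_ge: "m1\<^sup>2 \<le> m2"
proof -
  note M = truncated_geometric_moment[OF par(1-3) X[OF order_refl]]
  have 1: "integrable M (\<lambda>\<omega>. real (X 1 \<omega>))" "expectation (\<lambda>\<omega>. real (X 1 \<omega>)) = m1"
    using M[of 1] by (auto simp: has_bochner_integral_iff)
  have 2: "integrable M (\<lambda>\<omega>. (real (X 1 \<omega>))\<^sup>2)" "expectation (\<lambda>\<omega>. (real (X 1 \<omega>))\<^sup>2) = m2"
    using M[of 2] by (auto simp: has_bochner_integral_iff)
  show ?thesis
    using variance_eq[OF 1(1) 2(1)] variance_positive[of "\<lambda>\<omega>. real (X 1 \<omega>)"] 1(2) 2(2) by simp
qed

lemma S_moment: "has_bochner_integral M (S n) (real n * m1)"
proof -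
  have "has_bochner_integral M (\<lambda>\<omega>. \<Sum>i=1..n. real (X i \<omega>)) (\<Sum>i=1..n. m1)"
    using truncated_geometric_moment[OF par(1-3) X, where r=1] by (intro has_bochner_integral_sum) auto
  then show ?thesis by (simp add: S_def[abs_def])
qed

lemma X_product_moment:
  assumes "1 \<le> i" "1 \<le> j"
  shows "has_bochner_integral M (\<lambda>\<omega>. real (X i \<omega>) * real (X j \<omega>)) (m1\<^sup>2 + (if i = j then m2 - m1\<^sup>2 else 0))"
proof (cases "i = j")
  case True
  then show ?thesis
    using truncated_geometric_moment[OF par(1-3) X[OF assms(1)], of 2] by (simp add: power2_eq_square)
next
  case False
  have "indep_var (count_space UNIV) (X i) (count_space UNIV) (X j)"
    by (rule indep_vars_imp_indep_var[OF X_indep]) (use assms False in auto)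
  from indep_var_compose[OF this, of real borel real borel]
  have ind: "indep_var borel (\<lambda>\<omega>. real (X i \<omega>)) borel (\<lambda>\<omega>. real (X j \<omega>))"
    by (simp add: comp_def)
  show ?thesis
    using indep_var_lebesgue_integral[OF ind] indep_var_integrable[OF ind]
      truncated_geometric_moment[OF par(1-3) X[OF assms(1)], of 1]
      truncated_geometric_moment[OF par(1-3) X[OF assms(2)], of 1] False
    by (simp add: has_bochner_integral_iff power2_eq_square)
qed

lemma S_product_moment:
  "has_bochner_integral M (\<lambda>\<omega>. S a \<omega> * S b \<omega>) (real (min a b) * (m2 - m1\<^sup>2) + real a * real b * m1\<^sup>2)"
proof -
  have "has_bochner_integral M (\<lambda>\<omega>. \<Sum>i=1..a. \<Sum>j=1..b. real (X i \<omega>) * real (X j \<omega>))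
      (\<Sum>i=1..a. \<Sum>j=1..b. m1\<^sup>2 + (if i = j then m2 - m1\<^sup>2 else 0))"
    by (intro has_bochner_integral_sum X_product_moment) auto
  moreover have "(\<Sum>i=1..a. \<Sum>j=1..b. m1\<^sup>2 + (if i = j then m2 - m1\<^sup>2 else 0))
      = real (min a b) * (m2 - m1\<^sup>2) + real a * real b * m1\<^sup>2"
  proof -
    have "(\<Sum>i=1..a. if i \<in> {1..b} then m2 - m1\<^sup>2 else 0) = (\<Sum>i\<in>{1..a} \<inter> {1..b}. m2 - m1\<^sup>2)"
      by (rule sum.inter_restrict[symmetric]) simp
    also have "{1..a} \<inter> {1..b} = {1..min a b}" by auto
    finally have "(\<Sum>i=1..a. if i \<in> {1..b} then m2 - m1\<^sup>2 else 0) = real (min a b) * (m2 - m1\<^sup>2)"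
      by (simp del: One_nat_def)
    moreover have "(\<Sum>j=1..b. m1\<^sup>2 + (if i = j then m2 - m1\<^sup>2 else 0))
        = real b * m1\<^sup>2 + (if i \<in> {1..b} then m2 - m1\<^sup>2 else 0)" for i
      by (simp add: sum.distrib del: One_nat_def)
    ultimately show ?thesis
      by (simp add: sum.distrib del: One_nat_def)
  qed
  ultimately show ?thesis by (simp add: S_def sum_product)
qed

text \<open>
  The number of jumps is independent of the jump sizes, so the moments of the partial sums can be
  evaluated at the random number of summands.
\<close>

lemma N_moment_given_arrivals:
  shows "0 \<le> t \<Longrightarrow> (\<integral>\<^sup>+\<omega>. ennreal (N t \<omega>) \<partial>M) = (\<integral>\<^sup>+\<omega>. ennreal (real (N1 t \<omega>) * m1) \<partial>M)"
    and "0 \<le> a \<Longrightarrow> 0 \<le> b \<Longrightarrow> (\<integral>\<^sup>+\<omega>. ennreal (N a \<omega> * N b \<omega>) \<partial>M)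
      = (\<integral>\<^sup>+\<omega>. ennreal (real (min (N1 a \<omega>) (N1 b \<omega>)) * (m2 - m1\<^sup>2) + real (N1 a \<omega>) * real (N1 b \<omega>) * m1\<^sup>2) \<partial>M)"
proof -
  obtain F G where FG: "indep_set (sets F) (sets G)" "space F = space M" "space G = space M"
    and F: "\<And>t. t \<in> {0..} \<Longrightarrow> N1 t \<in> measurable F borel"
    and G: "\<And>i. i \<in> {1..} \<Longrightarrow> X i \<in> measurable G borel"
    using indep_familiesE[OF N1_X] by metis
  have N1_F: "N1 t \<in> measurable F (count_space UNIV)" if "0 \<le> t" for t
    using F[of t] that by (simp add: measurable_cong_sets[OF refl sets_borel_eq_count_space])
  have X_G: "X i \<in> measurable G (count_space UNIV)" if "1 \<le> i" for i
    using G[of i] that by (simp add: measurable_cong_sets[OF refl sets_borel_eq_count_space])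
  have S_G: "S n \<in> borel_measurable G" for n
    unfolding S_def[abs_def] by (intro borel_measurable_sum measurable_compose[OF X_G]) auto
  show "(\<integral>\<^sup>+\<omega>. ennreal (N t \<omega>) \<partial>M) = (\<integral>\<^sup>+\<omega>. ennreal (real (N1 t \<omega>) * m1) \<partial>M)" if t: "0 \<le> t"
  proof -
    have S_int: "(\<integral>\<^sup>+\<omega>'. ennreal (S n \<omega>') \<partial>M) = ennreal (real n * m1)" for n
      using S_moment[of n] by (subst nn_integral_eq_integral) (auto simp: has_bochner_integral_iff S_nonneg)
    have "(\<integral>\<^sup>+\<omega>. ennreal (N t \<omega>) \<partial>M) = (\<integral>\<^sup>+\<omega>. ennreal (S (N1 t \<omega>) \<omega>) \<partial>M)"
      using N_eq_S t by (intro nn_integral_cong_AE) (auto elim!: eventually_mono)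
    also have "\<dots> = (\<integral>\<^sup>+\<omega>. (\<integral>\<^sup>+\<omega>'. ennreal (S (N1 t \<omega>) \<omega>') \<partial>M) \<partial>M)"
      by (rule nn_integral_indep_index[OF FG N1_F[OF t], of "\<lambda>n \<omega>. ennreal (S n \<omega>)"])
         (rule measurable_compose[OF S_G], simp)
    finally show ?thesis unfolding S_int .
  qed
  show "(\<integral>\<^sup>+\<omega>. ennreal (N a \<omega> * N b \<omega>) \<partial>M)
      = (\<integral>\<^sup>+\<omega>. ennreal (real (min (N1 a \<omega>) (N1 b \<omega>)) * (m2 - m1\<^sup>2) + real (N1 a \<omega>) * real (N1 b \<omega>) * m1\<^sup>2) \<partial>M)"
    if ab: "0 \<le> a" "0 \<le> b"
  proof -
    have S_int: "(\<integral>\<^sup>+\<omega>'. ennreal (S i \<omega>' * S j \<omega>') \<partial>M) = ennreal (real (min i j) * (m2 - m1\<^sup>2) + real i * real j * m1\<^sup>2)" for i j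
      using S_product_moment[of i j]
      by (subst nn_integral_eq_integral) (auto simp: has_bochner_integral_iff S_nonneg)
    have "(\<integral>\<^sup>+\<omega>. ennreal (N a \<omega> * N b \<omega>) \<partial>M) = (\<integral>\<^sup>+\<omega>. ennreal (S (N1 a \<omega>) \<omega> * S (N1 b \<omega>) \<omega>) \<partial>M)"
      using N_eq_S ab by (intro nn_integral_cong_AE) (auto elim!: eventually_mono)
    also have "\<dots> = (\<integral>\<^sup>+\<omega>. (\<integral>\<^sup>+\<omega>'. ennreal (S (N1 a \<omega>) \<omega>' * S (N1 b \<omega>) \<omega>') \<partial>M) \<partial>M)"
      by (rule nn_integral_indep_index2[OF FG N1_F[OF ab(1)] N1_F[OF ab(2)], of "\<lambda>i j \<omega>. ennreal (S i \<omega> * S j \<omega>)"])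
         (rule measurable_compose[OF borel_measurable_times[OF S_G S_G]], simp)
    finally show ?thesis unfolding S_int .
  qed
qed

lemma N_moment:
  assumes "0 \<le> t"
  shows "has_bochner_integral M (N t) (lam * m1 * t)"
proof (rule has_bochner_integral_nn_integral)
  note m1 = truncated_geometric_moment_ge_1[OF par(1-3), of 1]
  show "AE \<omega> in M. 0 \<le> N t \<omega>" using N_path by eventually_elim (use assms in auto)
  show "0 \<le> lam * m1 * t" using assms par m1 by simp
  have "has_bochner_integral M (\<lambda>\<omega>. real (N1 t \<omega>) * m1) (lam * t * m1)"
    using m1 by (intro has_bochner_integral_mult_left poisson_process_moments[OF N1 assms])
  with N_moment_given_arrivals(1)[OF assms] show "(\<integral>\<^sup>+\<omega>. ennreal (N t \<omega>) \<partial>M) = ennreal (lam * m1 * t)"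
    using m1 by (subst (asm) nn_integral_eq_integral) (auto simp: has_bochner_integral_iff ac_simps)
qed (rule N_rv[OF assms])

lemma N_product_moment_le:
  assumes "0 \<le> a" "a \<le> b"
  shows "has_bochner_integral M (\<lambda>\<omega>. N a \<omega> * N b \<omega>) (lam * m2 * a + (lam * m1)\<^sup>2 * a * b)"
proof (rule has_bochner_integral_nn_integral)
  have b: "0 \<le> b" using assms by simp
  note m1 = truncated_geometric_moment_ge_1[OF par(1-3), of 1] and m2 = truncated_geometric_moment_ge_1[OF par(1-3), of 2]
  show "AE \<omega> in M. 0 \<le> N a \<omega> * N b \<omega>" using N_path by eventually_elim (use assms b in auto)
  show "0 \<le> lam * m2 * a + (lam * m1)\<^sup>2 * a * b" using assms b par m2 by simp
  show "random_variable borel (\<lambda>\<omega>. N a \<omega> * N b \<omega>)"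
    by (intro borel_measurable_times N_rv assms b)
  have I: "has_bochner_integral M (\<lambda>\<omega>. real (N1 a \<omega>) * (m2 - m1\<^sup>2) + real (N1 a \<omega>) * real (N1 b \<omega>) * m1\<^sup>2)
      (lam * a * (m2 - m1\<^sup>2) + (lam * a + lam\<^sup>2 * a * b) * m1\<^sup>2)"
    by (intro has_bochner_integral_add has_bochner_integral_mult_left
        poisson_process_moments[OF N1] poisson_process_product_moment[OF N1] assms)
  have "(\<integral>\<^sup>+\<omega>. ennreal (N a \<omega> * N b \<omega>) \<partial>M)
      = (\<integral>\<^sup>+\<omega>. ennreal (real (N1 a \<omega>) * (m2 - m1\<^sup>2) + real (N1 a \<omega>) * real (N1 b \<omega>) * m1\<^sup>2) \<partial>M)"
    unfolding N_moment_given_arrivals(2)[OF assms(1) b]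
    using poisson_process_mono[OF N1] assms b
    by (intro nn_integral_cong_AE) (auto elim!: eventually_mono dest!: mono_onD[where r=a and s=b] simp: min_def)
  also have "\<dots> = ennreal (lam * a * (m2 - m1\<^sup>2) + (lam * a + lam\<^sup>2 * a * b) * m1\<^sup>2)"
    using I m2_ge by (subst nn_integral_eq_integral) (auto simp: has_bochner_integral_iff)
  also have "lam * a * (m2 - m1\<^sup>2) + (lam * a + lam\<^sup>2 * a * b) * m1\<^sup>2 = lam * m2 * a + (lam * m1)\<^sup>2 * a * b"
    by (simp add: algebra_simps power2_eq_square)
  finally show "(\<integral>\<^sup>+\<omega>. ennreal (N a \<omega> * N b \<omega>) \<partial>M) = ennreal (lam * m2 * a + (lam * m1)\<^sup>2 * a * b)" .
qed

lemma N_product_moment: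
  assumes "0 \<le> a" "0 \<le> b"
  shows "has_bochner_integral M (\<lambda>\<omega>. N a \<omega> * N b \<omega>) (lam * m2 * min a b + (lam * m1)\<^sup>2 * (a * b))"
  using N_product_moment_le[of a b] N_product_moment_le[of b a] assms
  by (cases "a \<le> b") (simp_all add: ac_simps min_def)

end

section \<open>Time change by the inverse subordinator\<close>

lemma ennreal_eq_squeeze_at_right_0:
  fixes J :: ennreal and lo up :: "real \<Rightarrow> real"
  assumes "\<And>h. 0 < h \<Longrightarrow> ennreal (lo h) \<le> J" "\<And>h. 0 < h \<Longrightarrow> J \<le> ennreal (up h)"
    and "(lo \<longlongrightarrow> c) (at_right 0)" "(up \<longlongrightarrow> c) (at_right 0)"
  shows "J = ennreal c"
proof (rule antisym)
  have ev: "\<forall>\<^sub>F h::real in at_right 0. 0 < h" by (simp add: eventually_at_right_less)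
  show "J \<le> ennreal c"
    by (rule tendsto_lowerbound[OF tendsto_ennrealI[OF assms(4)] eventually_mono[OF ev assms(2)]]) simp_all
  show "ennreal c \<le> J"
    by (rule tendsto_upperbound[OF tendsto_ennrealI[OF assms(3)] eventually_mono[OF ev assms(1)]]) simp_all
qed

text \<open>
  The right-hand side ignores the negative part of \<open>f\<close>.  Lower bounds of grid values may be
  negative, which is why they are integrated in this form.
\<close>

lemma ennreal_expectation_le_nn_integral:
  fixes f :: "'a \<Rightarrow> real"
  assumes f: "integrable M f"
  shows "ennreal (\<integral>\<omega>. f \<omega> \<partial>M) \<le> (\<integral>\<^sup>+\<omega>. ennreal (f \<omega>) \<partial>M)"
proof -
  have "ennreal (\<integral>\<omega>. f \<omega> \<partial>M) \<le> ennreal (\<integral>\<omega>. max 0 (f \<omega>) \<partial>M)"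
    using f by (intro ennreal_leI integral_mono) auto
  also have "\<dots> = (\<integral>\<^sup>+\<omega>. ennreal (max 0 (f \<omega>)) \<partial>M)"
    using f by (intro nn_integral_eq_integral[symmetric]) auto
  also have "\<dots> = (\<integral>\<^sup>+\<omega>. ennreal (f \<omega>) \<partial>M)"
    by (intro nn_integral_cong) (auto simp: max_def ennreal_neg)
  finally show ?thesis .
qed

text \<open>
  Only the means, the mixed second moments and the monotone paths of the outer process matter.  The
  form of the moments is that of a square integrable Levy process, \<open>\<mu>\<close> being the mean and \<open>\<kappa>\<close>
  the variance per unit of time.
\<close>

locale time_changed = inverse_stable M \<alpha> L Y
  for M :: "'a measure" and \<alpha> and L Y :: "real \<Rightarrow> 'a \<Rightarrow> real" +
  fixes N Nh :: "real \<Rightarrow> 'a \<Rightarrow> real" and \<kappa> \<mu> :: real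
  assumes N_rv: "\<And>t. 0 \<le> t \<Longrightarrow> random_variable borel (N t)"
    and N_path: "AE \<omega> in M. mono_on {0..} (\<lambda>t. N t \<omega>) \<and> (\<forall>t\<ge>0. 0 \<le> N t \<omega>)"
    and N_moment: "\<And>t. 0 \<le> t \<Longrightarrow> has_bochner_integral M (N t) (\<mu> * t)"
    and N_product_moment: "\<And>a b. 0 \<le> a \<Longrightarrow> 0 \<le> b \<Longrightarrow>
        has_bochner_integral M (\<lambda>\<omega>. N a \<omega> * N b \<omega>) (\<kappa> * min a b + \<mu>\<^sup>2 * (a * b))"
    and pos: "0 < \<kappa>" "0 < \<mu>"
    and Y_N: "indep_families {0..} Y {0..} N"
    and Nh: "real_process Nh"
    and Nh_eq: "AE \<omega> in M. \<forall>t\<ge>0. Nh t \<omega> = N (Y t \<omega>) \<omega>"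
begin

lemma Nh_rv[measurable]: "0 \<le> t \<Longrightarrow> random_variable borel (Nh t)"
  using Nh by (simp add: real_process_def)

text \<open>
  The number of the grid point of mesh \<open>h\<close> at or below \<open>Y t\<close>.  Negative values of \<open>Y t\<close>, which occur
  with probability 0 only, are sent to 0.
\<close>

definition grid :: "real \<Rightarrow> real \<Rightarrow> 'a \<Rightarrow> nat" where
  "grid h t \<omega> = nat \<lfloor>Y t \<omega> / h\<rfloor>"

lemma grid_bounds:
  assumes "0 < h" "0 \<le> Y t \<omega>"
  shows "Y t \<omega> - h \<le> real (grid h t \<omega>) * h" "real (grid h t \<omega>) * h \<le> Y t \<omega>"
    "Y t \<omega> \<le> real (Suc (grid h t \<omega>)) * h" "real (Suc (grid h t \<omega>)) * h \<le> Y t \<omega> + h"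
proof -
  have g: "real (grid h t \<omega>) = of_int \<lfloor>Y t \<omega> / h\<rfloor>"
    using assms by (simp add: grid_def)
  have "real (grid h t \<omega>) \<le> Y t \<omega> / h" "Y t \<omega> / h \<le> real (grid h t \<omega>) + 1"
    unfolding g by linarith+
  then have *: "real (grid h t \<omega>) * h \<le> Y t \<omega>" "Y t \<omega> \<le> (real (grid h t \<omega>) + 1) * h"
    using assms(1) by (simp_all add: pos_le_divide_eq pos_divide_le_eq)
  then show "Y t \<omega> - h \<le> real (grid h t \<omega>) * h" "real (grid h t \<omega>) * h \<le> Y t \<omega>"
    "Y t \<omega> \<le> real (Suc (grid h t \<omega>)) * h" "real (Suc (grid h t \<omega>)) * h \<le> Y t \<omega> + h"
    by (simp_all add: algebra_simps)
qed

text \<open>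
  A grid value is a countable random index independent of \<open>N\<close>.  With \<open>f n = n\<close> and \<open>f = Suc\<close>
  the moments at the lower and at the upper grid point are obtained together.
\<close>

lemma N_grid_moment:
  fixes f :: "nat \<Rightarrow> nat"
  assumes h: "0 < h"
  shows "0 \<le> t \<Longrightarrow> (\<integral>\<^sup>+\<omega>. ennreal (N (real (f (grid h t \<omega>)) * h) \<omega>) \<partial>M)
      = (\<integral>\<^sup>+\<omega>. ennreal (\<mu> * (real (f (grid h t \<omega>)) * h)) \<partial>M)"
    and "0 \<le> s \<Longrightarrow> 0 \<le> t \<Longrightarrow>
      (\<integral>\<^sup>+\<omega>. ennreal (N (real (f (grid h s \<omega>)) * h) \<omega> * N (real (f (grid h t \<omega>)) * h) \<omega>) \<partial>M)
      = (\<integral>\<^sup>+\<omega>. ennreal (\<kappa> * min (real (f (grid h s \<omega>)) * h) (real (f (grid h t \<omega>)) * h)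
          + \<mu>\<^sup>2 * ((real (f (grid h s \<omega>)) * h) * (real (f (grid h t \<omega>)) * h))) \<partial>M)"
proof -
  obtain F G where FG: "indep_set (sets F) (sets G)" "space F = space M" "space G = space M"
    and F: "\<And>t. t \<in> {0..} \<Longrightarrow> Y t \<in> measurable F borel"
    and G: "\<And>t. t \<in> {0..} \<Longrightarrow> N t \<in> measurable G borel"
    using indep_familiesE[OF Y_N] by metis
  have K: "(\<lambda>\<omega>. f (grid h t \<omega>)) \<in> measurable F (count_space UNIV)" if "0 \<le> t" for t
  proof -
    have [measurable]: "Y t \<in> borel_measurable F" using F[of t] that by simp
    have "grid h t \<in> measurable F (count_space UNIV)" unfolding grid_def[abs_def] by measurable
    from measurable_compose[OF this, of f] show ?thesis by simp
  qed
  have N_G: "N (real i * h) \<in> borel_measurable G" for i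
    using G[of "real i * h"] h by simp
  have nonneg: "AE \<omega> in M. 0 \<le> N (real i * h) \<omega>" for i
    using N_path by eventually_elim (use h in auto)
  have i1: "(\<integral>\<^sup>+\<omega>'. ennreal (N (real i * h) \<omega>') \<partial>M) = ennreal (\<mu> * (real i * h))" for i
    using N_moment[of "real i * h"] h nonneg
    by (subst nn_integral_eq_integral) (auto simp: has_bochner_integral_iff)
  have i2: "(\<integral>\<^sup>+\<omega>'. ennreal (N (real i * h) \<omega>' * N (real j * h) \<omega>') \<partial>M)
      = ennreal (\<kappa> * min (real i * h) (real j * h) + \<mu>\<^sup>2 * ((real i * h) * (real j * h)))" for i j
  proof -
    have "AE \<omega> in M. 0 \<le> N (real i * h) \<omega> * N (real j * h) \<omega>"
      using nonneg[of i] nonneg[of j] by eventually_elim simp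
    then show ?thesis
      using N_product_moment[of "real i * h" "real j * h"] h
      by (subst nn_integral_eq_integral) (auto simp: has_bochner_integral_iff)
  qed
  show "(\<integral>\<^sup>+\<omega>. ennreal (N (real (f (grid h t \<omega>)) * h) \<omega>) \<partial>M)
      = (\<integral>\<^sup>+\<omega>. ennreal (\<mu> * (real (f (grid h t \<omega>)) * h)) \<partial>M)" if "0 \<le> t"
    by (subst nn_integral_indep_index[OF FG K[OF that], of "\<lambda>i \<omega>. ennreal (N (real i * h) \<omega>)"])
       (auto simp: i1 intro: measurable_compose[OF N_G])
  show "(\<integral>\<^sup>+\<omega>. ennreal (N (real (f (grid h s \<omega>)) * h) \<omega> * N (real (f (grid h t \<omega>)) * h) \<omega>) \<partial>M)
      = (\<integral>\<^sup>+\<omega>. ennreal (\<kappa> * min (real (f (grid h s \<omega>)) * h) (real (f (grid h t \<omega>)) * h)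
          + \<mu>\<^sup>2 * ((real (f (grid h s \<omega>)) * h) * (real (f (grid h t \<omega>)) * h))) \<partial>M)"
    if "0 \<le> s" "0 \<le> t"
    by (subst nn_integral_indep_index2[OF FG K[OF that(1)] K[OF that(2)],
          of "\<lambda>i j \<omega>. ennreal (N (real i * h) \<omega> * N (real j * h) \<omega>)"])
       (auto simp: i2 intro: measurable_compose[OF borel_measurable_times[OF N_G N_G]])
qed

text \<open>
  Monotone paths enclose \<open>N (Y t)\<close> between the values of \<open>N\<close> at the neighbouring grid points.
\<close>

lemma Nh_grid_bounds:
  assumes h: "0 < h"
  shows "AE \<omega> in M. \<forall>t\<ge>0. 0 \<le> Nh t \<omega> \<and> 0 \<le> N (real (grid h t \<omega>) * h) \<omega> \<and>
      N (real (grid h t \<omega>) * h) \<omega> \<le> Nh t \<omega> \<and> Nh t \<omega> \<le> N (real (Suc (grid h t \<omega>)) * h) \<omega>"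
  using N_path Nh_eq Y_path
proof eventually_elim
  case (elim \<omega>)
  show ?case
  proof (intro allI impI)
    fix t :: real assume t: "0 \<le> t"
    have Y0: "0 \<le> Y t \<omega>" using elim(3) t by blast
    have eq: "Nh t \<omega> = N (Y t \<omega>) \<omega>" using elim(2) t by blast
    have mono: "N a \<omega> \<le> N b \<omega>" if "0 \<le> a" "a \<le> b" for a b
      using mono_onD[of "{0..}" "\<lambda>t. N t \<omega>" a b] elim(1) that by auto
    show "0 \<le> Nh t \<omega> \<and> 0 \<le> N (real (grid h t \<omega>) * h) \<omega> \<and>
      N (real (grid h t \<omega>) * h) \<omega> \<le> Nh t \<omega> \<and> Nh t \<omega> \<le> N (real (Suc (grid h t \<omega>)) * h) \<omega>"
      unfolding eq using elim(1) Y0 h grid_bounds[OF h Y0]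
      by (intro conjI mono) auto
  qed
qed

lemma Nh_nonneg: "AE \<omega> in M. \<forall>t\<ge>0. 0 \<le> Nh t \<omega>"
  using Nh_grid_bounds[OF zero_less_one] by eventually_elim blast

text \<open>
  The moments at the lower and the upper grid points are explicit, differ by at most a multiple of
  the mesh \<open>h\<close>, and enclose the moment of \<open>Nh t\<close>.
\<close>

lemma Nh_moment:
  assumes t: "0 \<le> t"
  shows "has_bochner_integral M (Nh t) (\<mu> * expectation (Y t))"
proof (rule has_bochner_integral_nn_integral)
  show "AE \<omega> in M. 0 \<le> Nh t \<omega>" using Nh_nonneg by eventually_elim (use t in blast)
  show "0 \<le> \<mu> * expectation (Y t)" using pos expectation_Y_nonneg[OF t] by simp
  note intY = integrable_Y[OF t]
  show "(\<integral>\<^sup>+\<omega>. ennreal (Nh t \<omega>) \<partial>M) = ennreal (\<mu> * expectation (Y t))"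
  proof (rule ennreal_eq_squeeze_at_right_0)
    fix h :: real assume h: "0 < h"
    have "ennreal (\<mu> * (expectation (Y t) - h)) = ennreal (expectation (\<lambda>\<omega>. \<mu> * (Y t \<omega> - h)))"
      using intY by (simp add: prob_space)
    also have "\<dots> \<le> (\<integral>\<^sup>+\<omega>. ennreal (\<mu> * (Y t \<omega> - h)) \<partial>M)"
      using intY by (intro ennreal_expectation_le_nn_integral) simp
    also have "\<dots> \<le> (\<integral>\<^sup>+\<omega>. ennreal (\<mu> * (real (grid h t \<omega>) * h)) \<partial>M)"
      using Y_nonneg[OF t] pos
      by (intro nn_integral_mono_AE) (auto elim!: eventually_mono intro!: ennreal_leI mult_left_mono grid_bounds h)
    also have "\<dots> = (\<integral>\<^sup>+\<omega>. ennreal (N (real (grid h t \<omega>) * h) \<omega>) \<partial>M)"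
      using N_grid_moment(1)[OF h, where f="\<lambda>n. n"] t by simp
    also have "\<dots> \<le> (\<integral>\<^sup>+\<omega>. ennreal (Nh t \<omega>) \<partial>M)"
      using Nh_grid_bounds[OF h] t by (intro nn_integral_mono_AE) (auto elim!: eventually_mono intro!: ennreal_leI)
    finally show "ennreal (\<mu> * (expectation (Y t) - h)) \<le> (\<integral>\<^sup>+\<omega>. ennreal (Nh t \<omega>) \<partial>M)" .
    have "(\<integral>\<^sup>+\<omega>. ennreal (Nh t \<omega>) \<partial>M) \<le> (\<integral>\<^sup>+\<omega>. ennreal (N (real (Suc (grid h t \<omega>)) * h) \<omega>) \<partial>M)"
      using Nh_grid_bounds[OF h] t
      by (intro nn_integral_mono_AE) (auto elim!: eventually_mono intro!: ennreal_leI simp del: of_nat_Suc)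
    also have "\<dots> = (\<integral>\<^sup>+\<omega>. ennreal (\<mu> * (real (Suc (grid h t \<omega>)) * h)) \<partial>M)"
      using N_grid_moment(1)[OF h, where f=Suc] t by simp
    also have "\<dots> \<le> (\<integral>\<^sup>+\<omega>. ennreal (\<mu> * (Y t \<omega> + h)) \<partial>M)"
      using Y_nonneg[OF t] pos
      by (intro nn_integral_mono_AE)
        (auto elim!: eventually_mono intro!: ennreal_leI mult_left_mono grid_bounds h simp del: of_nat_Suc)
    also have "\<dots> = ennreal (expectation (\<lambda>\<omega>. \<mu> * (Y t \<omega> + h)))"
      using Y_nonneg[OF t] intY pos h
      by (intro nn_integral_eq_integral) (auto elim!: eventually_mono)
    also have "\<dots> = ennreal (\<mu> * (expectation (Y t) + h))"
      using intY by (simp add: prob_space)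
    finally show "(\<integral>\<^sup>+\<omega>. ennreal (Nh t \<omega>) \<partial>M) \<le> ennreal (\<mu> * (expectation (Y t) + h))" .
  next
    show "((\<lambda>h. \<mu> * (expectation (Y t) - h)) \<longlongrightarrow> \<mu> * expectation (Y t)) (at_right 0)"
      by (rule tendsto_eq_intros | simp)+
    show "((\<lambda>h. \<mu> * (expectation (Y t) + h)) \<longlongrightarrow> \<mu> * expectation (Y t)) (at_right 0)"
      by (rule tendsto_eq_intros | simp)+
  qed
qed (use t in simp)

lemma product_lower_bound:
  fixes a b a' b' h :: real
  assumes "0 \<le> a'" "0 \<le> b'" "a - h \<le> a'" "b - h \<le> b'" "a' \<le> a" "b' \<le> b"
  shows "a * b - h * (a + b) \<le> a' * b'"
proof -
  have "(a - a') * b \<le> h * b" "(b - b') * a' \<le> h * a'" "h * a' \<le> h * a"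
    using assms by (auto intro!: mult_right_mono mult_left_mono)
  then show ?thesis by (simp add: algebra_simps)
qed

text \<open>
  The same enclosure for mixed second moments.  For \<open>s \<le> t\<close> it gives the identity obtained from
  \<open>E (N a * N b) = \<kappa> * min a b + \<mu>\<^sup>2 * a * b\<close> by substituting \<open>Y s\<close> and \<open>Y t\<close> for \<open>a\<close> and \<open>b\<close> and taking
  expectations.
\<close>

lemma Nh_product_moment:
  assumes s: "0 \<le> s" "s \<le> t"
  shows "has_bochner_integral M (\<lambda>\<omega>. Nh s \<omega> * Nh t \<omega>)
    (\<kappa> * expectation (Y s) + \<mu>\<^sup>2 * expectation (\<lambda>\<omega>. Y s \<omega> * Y t \<omega>))"
proof (rule has_bochner_integral_nn_integral)
  have t: "0 \<le> t" using s by simp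
  note [measurable] = Nh_rv[OF s(1)] Nh_rv[OF t]
  show "AE \<omega> in M. 0 \<le> Nh s \<omega> * Nh t \<omega>" using Nh_nonneg by eventually_elim (use s t in simp)
  have Y0: "AE \<omega> in M. 0 \<le> Y s \<omega> \<and> 0 \<le> Y t \<omega> \<and> Y s \<omega> \<le> Y t \<omega>"
    using Y_nonneg[OF s(1)] Y_nonneg[OF t] Y_mono[OF s] by eventually_elim simp
  have "0 \<le> expectation (\<lambda>\<omega>. Y s \<omega> * Y t \<omega>)"
    by (rule integral_nonneg_AE) (use Y0 in \<open>eventually_elim, simp\<close>)
  then show "0 \<le> \<kappa> * expectation (Y s) + \<mu>\<^sup>2 * expectation (\<lambda>\<omega>. Y s \<omega> * Y t \<omega>)"
    using pos expectation_Y_nonneg[OF s(1)] by simp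
  note intY = integrable_Y[OF s(1)] integrable_Y[OF t] integrable_Y_mult[OF s(1) t]
  \<comment> \<open>Bounds for the mixed moment at the two grid points; the lower one need not be positive.\<close>
  define lo where "lo h a b = \<kappa> * (a - h) + \<mu>\<^sup>2 * (a * b - h * (a + b))" for h a b :: real
  define up where "up h a b = \<kappa> * (a + h) + \<mu>\<^sup>2 * (a * b + h * (a + b) + h * h)" for h a b :: real
  let ?e = "\<kappa> * expectation (Y s)" and ?p = "expectation (\<lambda>\<omega>. Y s \<omega> * Y t \<omega>)"
  let ?g = "\<lambda>f h r \<omega>. real (f (grid h r \<omega>)) * h"
  let ?q = "\<lambda>a b. \<kappa> * min a b + \<mu>\<^sup>2 * (a * b)"
  have int_lo: "integrable M (\<lambda>\<omega>. lo h (Y s \<omega>) (Y t \<omega>))" for h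
    unfolding lo_def using intY by simp
  have int_up: "integrable M (\<lambda>\<omega>. up h (Y s \<omega>) (Y t \<omega>))" for h
    unfolding up_def using intY by simp
  show "(\<integral>\<^sup>+\<omega>. ennreal (Nh s \<omega> * Nh t \<omega>) \<partial>M) = ennreal (?e + \<mu>\<^sup>2 * ?p)"
  proof (rule ennreal_eq_squeeze_at_right_0)
    fix h :: real assume h: "0 < h"
    have "ennreal (expectation (\<lambda>\<omega>. lo h (Y s \<omega>) (Y t \<omega>))) \<le> (\<integral>\<^sup>+\<omega>. ennreal (lo h (Y s \<omega>) (Y t \<omega>)) \<partial>M)"
      by (rule ennreal_expectation_le_nn_integral[OF int_lo])
    also have "\<dots> \<le> (\<integral>\<^sup>+\<omega>. ennreal (?q (?g (\<lambda>n. n) h s \<omega>) (?g (\<lambda>n. n) h t \<omega>)) \<partial>M)"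
    proof (rule nn_integral_mono_AE)
      show "AE \<omega> in M. ennreal (lo h (Y s \<omega>) (Y t \<omega>)) \<le> ennreal (?q (?g (\<lambda>n. n) h s \<omega>) (?g (\<lambda>n. n) h t \<omega>))"
        using Y0
      proof eventually_elim
        case (elim \<omega>)
        then have gs: "Y s \<omega> - h \<le> ?g (\<lambda>n. n) h s \<omega>" "?g (\<lambda>n. n) h s \<omega> \<le> Y s \<omega>"
          and gt: "Y t \<omega> - h \<le> ?g (\<lambda>n. n) h t \<omega>" "?g (\<lambda>n. n) h t \<omega> \<le> Y t \<omega>"
          using grid_bounds[OF h, of s \<omega>] grid_bounds[OF h, of t \<omega>] by auto
        have "\<kappa> * (Y s \<omega> - h) \<le> \<kappa> * min (?g (\<lambda>n. n) h s \<omega>) (?g (\<lambda>n. n) h t \<omega>)"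
          using gs gt elim pos by (intro mult_left_mono) auto
        moreover have "\<mu>\<^sup>2 * (Y s \<omega> * Y t \<omega> - h * (Y s \<omega> + Y t \<omega>)) \<le> \<mu>\<^sup>2 * (?g (\<lambda>n. n) h s \<omega> * ?g (\<lambda>n. n) h t \<omega>)"
          using gs gt elim h by (intro mult_left_mono product_lower_bound) auto
        ultimately show ?case unfolding lo_def by (intro ennreal_leI add_mono)
      qed
    qed
    also have "\<dots> = (\<integral>\<^sup>+\<omega>. ennreal (N (?g (\<lambda>n. n) h s \<omega>) \<omega> * N (?g (\<lambda>n. n) h t \<omega>) \<omega>) \<partial>M)"
      using N_grid_moment(2)[OF h, where f="\<lambda>n. n"] s(1) t by simp
    also have "\<dots> \<le> (\<integral>\<^sup>+\<omega>. ennreal (Nh s \<omega> * Nh t \<omega>) \<partial>M)"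
      using Nh_grid_bounds[OF h] s(1) t
      by (intro nn_integral_mono_AE) (auto elim!: eventually_mono intro!: ennreal_leI mult_mono)
    finally show "ennreal (expectation (\<lambda>\<omega>. lo h (Y s \<omega>) (Y t \<omega>))) \<le> (\<integral>\<^sup>+\<omega>. ennreal (Nh s \<omega> * Nh t \<omega>) \<partial>M)" .
    have "(\<integral>\<^sup>+\<omega>. ennreal (Nh s \<omega> * Nh t \<omega>) \<partial>M) \<le> (\<integral>\<^sup>+\<omega>. ennreal (N (?g Suc h s \<omega>) \<omega> * N (?g Suc h t \<omega>) \<omega>) \<partial>M)"
    proof (rule nn_integral_mono_AE)
      show "AE \<omega> in M. ennreal (Nh s \<omega> * Nh t \<omega>) \<le> ennreal (N (?g Suc h s \<omega>) \<omega> * N (?g Suc h t \<omega>) \<omega>)"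
        using Nh_grid_bounds[OF h]
      proof eventually_elim
        case (elim \<omega>)
        from elim[rule_format, OF s(1)] elim[rule_format, OF t]
        show ?case by (intro ennreal_leI mult_mono) auto
      qed
    qed
    also have "\<dots> = (\<integral>\<^sup>+\<omega>. ennreal (?q (?g Suc h s \<omega>) (?g Suc h t \<omega>)) \<partial>M)"
      using N_grid_moment(2)[OF h, where f=Suc] s(1) t by simp
    also have "\<dots> \<le> (\<integral>\<^sup>+\<omega>. ennreal (up h (Y s \<omega>) (Y t \<omega>)) \<partial>M)"
    proof (rule nn_integral_mono_AE)
      show "AE \<omega> in M. ennreal (?q (?g Suc h s \<omega>) (?g Suc h t \<omega>)) \<le> ennreal (up h (Y s \<omega>) (Y t \<omega>))"
        using Y0
      proof eventually_elim
        case (elim \<omega>)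
        then have gs: "?g Suc h s \<omega> \<le> Y s \<omega> + h" and gt: "?g Suc h t \<omega> \<le> Y t \<omega> + h"
          using grid_bounds(4)[OF h, of s \<omega>] grid_bounds(4)[OF h, of t \<omega>] by auto
        have nn: "0 \<le> ?g Suc h s \<omega>" "0 \<le> ?g Suc h t \<omega>" using h by auto
        have "\<kappa> * min (?g Suc h s \<omega>) (?g Suc h t \<omega>) \<le> \<kappa> * (Y s \<omega> + h)"
          using gs pos by (intro mult_left_mono min.coboundedI1) auto
        moreover have "\<mu>\<^sup>2 * (?g Suc h s \<omega> * ?g Suc h t \<omega>) \<le> \<mu>\<^sup>2 * ((Y s \<omega> + h) * (Y t \<omega> + h))"
          using gs gt nn elim h by (intro mult_left_mono mult_mono) auto
        moreover have "(Y s \<omega> + h) * (Y t \<omega> + h) = Y s \<omega> * Y t \<omega> + h * (Y s \<omega> + Y t \<omega>) + h * h"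
          by (simp add: algebra_simps)
        ultimately show ?case unfolding up_def by (intro ennreal_leI add_mono) simp_all
      qed
    qed
    also have "\<dots> = ennreal (expectation (\<lambda>\<omega>. up h (Y s \<omega>) (Y t \<omega>)))"
    proof (rule nn_integral_eq_integral[OF int_up])
      show "AE \<omega> in M. 0 \<le> up h (Y s \<omega>) (Y t \<omega>)"
        using Y0 by eventually_elim (use pos h in \<open>simp add: up_def\<close>)
    qed
    finally show "(\<integral>\<^sup>+\<omega>. ennreal (Nh s \<omega> * Nh t \<omega>) \<partial>M) \<le> ennreal (expectation (\<lambda>\<omega>. up h (Y s \<omega>) (Y t \<omega>)))" .
  next
    have "(\<lambda>h. expectation (\<lambda>\<omega>. lo h (Y s \<omega>) (Y t \<omega>)))
        = (\<lambda>h. \<kappa> * (expectation (Y s) - h) + \<mu>\<^sup>2 * (?p - h * (expectation (Y s) + expectation (Y t))))"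
      unfolding lo_def using intY by (simp add: prob_space)
    moreover have "(\<dots> \<longlongrightarrow> \<kappa> * (expectation (Y s) - 0) + \<mu>\<^sup>2 * (?p - 0 * (expectation (Y s) + expectation (Y t)))) (at_right 0)"
      by (intro tendsto_intros)
    ultimately show "((\<lambda>h. expectation (\<lambda>\<omega>. lo h (Y s \<omega>) (Y t \<omega>))) \<longlongrightarrow> ?e + \<mu>\<^sup>2 * ?p) (at_right 0)"
      by simp
    have "(\<lambda>h. expectation (\<lambda>\<omega>. up h (Y s \<omega>) (Y t \<omega>)))
        = (\<lambda>h. \<kappa> * (expectation (Y s) + h) + \<mu>\<^sup>2 * (?p + h * (expectation (Y s) + expectation (Y t)) + h * h))"
      unfolding up_def using intY by (simp add: prob_space)
    moreover have "(\<dots> \<longlongrightarrow> \<kappa> * (expectation (Y s) + 0) + \<mu>\<^sup>2 * (?p + 0 * (expectation (Y s) + expectation (Y t)) + 0 * 0)) (at_right 0)"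
      by (intro tendsto_intros)
    ultimately show "((\<lambda>h. expectation (\<lambda>\<omega>. up h (Y s \<omega>) (Y t \<omega>))) \<longlongrightarrow> ?e + \<mu>\<^sup>2 * ?p) (at_right 0)"
      by simp
  qed
qed (use s in simp)

section \<open>Long-range dependence\<close>

lemma Nh_covariance:
  assumes s: "0 \<le> s" "s \<le> t"
  shows "covariance (Nh s) (Nh t) = \<kappa> * expectation (Y s)
    + \<mu>\<^sup>2 * (expectation (\<lambda>\<omega>. Y s \<omega> * Y t \<omega>) - expectation (Y s) * expectation (Y t))"
proof -
  have t: "0 \<le> t" using s by simp
  note m = Nh_moment[OF s(1)] Nh_moment[OF t] Nh_product_moment[OF s]
  have "covariance (Nh s) (Nh t) = expectation (\<lambda>\<omega>. Nh s \<omega> * Nh t \<omega> - expectation (Nh t) * Nh s \<omega>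
      - expectation (Nh s) * Nh t \<omega> + expectation (Nh s) * expectation (Nh t))"
    unfolding covariance_def by (simp add: algebra_simps)
  also have "\<dots> = expectation (\<lambda>\<omega>. Nh s \<omega> * Nh t \<omega>) - expectation (Nh s) * expectation (Nh t)"
    using m by (simp add: has_bochner_integral_iff prob_space)
  also have "\<dots> = \<kappa> * expectation (Y s)
    + \<mu>\<^sup>2 * (expectation (\<lambda>\<omega>. Y s \<omega> * Y t \<omega>) - expectation (Y s) * expectation (Y t))"
    using m by (simp add: has_bochner_integral_iff algebra_simps power2_eq_square)
  finally show ?thesis .
qed

lemma Nh_variance:
  assumes t: "0 < t"
  shows "variance (Nh t) = \<kappa> * expectation (Y 1) * t powr \<alpha> + \<mu>\<^sup>2 * variance (Y 1) * (t powr \<alpha>)\<^sup>2"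
proof -
  have "variance (Nh t) = covariance (Nh t) (Nh t)"
    by (simp add: covariance_def power2_eq_square)
  also have "\<dots> = \<kappa> * expectation (Y t) + \<mu>\<^sup>2 * (expectation (\<lambda>\<omega>. (Y t \<omega>)\<^sup>2) - (expectation (Y t))\<^sup>2)"
    using Nh_covariance[of t t] t by (simp add: power2_eq_square)
  also have "\<dots> = \<kappa> * expectation (Y 1) * t powr \<alpha> + \<mu>\<^sup>2 * variance (Y 1) * (t powr \<alpha>)\<^sup>2"
  proof -
    have "expectation (\<lambda>\<omega>. (Y 1 \<omega>)\<^sup>2) = variance (Y 1) + (expectation (Y 1))\<^sup>2"
      using variance_eq[OF integrable_Y[OF zero_le_one] integrable_Y_square[OF zero_le_one]] by simp
    then show ?thesis
      by (simp add: expectation_Y_scaling[OF t] expectation_Y_square_scaling[OF t] algebra_simps power_mult_distrib)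
  qed
  finally show ?thesis .
qed

text \<open>
  The covariance tends to a positive constant, while the standard deviation of \<open>Nh t\<close> is asymptotic
  to a multiple of \<open>t powr \<alpha>\<close>, because the quadratic term in \<open>t powr \<alpha>\<close> dominates the variance.
  Hence the correlation decays with exponent \<open>\<alpha>\<close>.
\<close>

lemma Nh_long_range_dependent: "long_range_dependent Nh"
  unfolding long_range_dependent_def
proof (rule exI[of _ \<alpha>], intro conjI allI impI \<alpha>)
  fix s :: real assume s: "0 < s"
  define A where "A = \<kappa> * expectation (Y 1)"
  define B where "B = \<mu>\<^sup>2 * variance (Y 1)"
  define K where "K = \<kappa> * expectation (Y s) + \<mu>\<^sup>2 * (expectation (\<lambda>\<omega>. (Y s \<omega>)\<^sup>2) / 2)"
  define V where "V = sqrt (variance (Nh s))"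
  have A: "0 < A" unfolding A_def using pos expectation_Y_pos[of 1] by simp
  have B: "0 < B" unfolding B_def using pos variance_Y_pos by simp
  have K: "0 < K" unfolding K_def using pos expectation_Y_pos[OF s] by (intro add_pos_nonneg) auto
  have V: "0 < V" unfolding V_def Nh_variance[OF s] A_def[symmetric] B_def[symmetric]
    using A B s by (simp add: add_pos_pos)
  have cov: "((\<lambda>t. covariance (Nh s) (Nh t)) \<longlongrightarrow> K) at_top"
  proof (rule Lim_transform_eventually)
    show "((\<lambda>t. \<kappa> * expectation (Y s) + \<mu>\<^sup>2 * (expectation (\<lambda>\<omega>. Y s \<omega> * Y t \<omega>) - expectation (Y s) * expectation (Y t)))
      \<longlongrightarrow> K) at_top"
      unfolding K_def by (intro tendsto_intros Y_covariance_tendsto s)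
    show "\<forall>\<^sub>F t in at_top. \<kappa> * expectation (Y s) + \<mu>\<^sup>2 * (expectation (\<lambda>\<omega>. Y s \<omega> * Y t \<omega>) - expectation (Y s) * expectation (Y t))
      = covariance (Nh s) (Nh t)"
      using eventually_ge_at_top[of s] by eventually_elim (use s Nh_covariance in simp)
  qed
  have sd: "((\<lambda>t. t powr \<alpha> / sqrt (A * t powr \<alpha> + B * (t powr \<alpha>)\<^sup>2)) \<longlongrightarrow> 1 / sqrt B) at_top"
  proof (rule Lim_transform_eventually)
    have "((\<lambda>t. t powr (- \<alpha>)) \<longlongrightarrow> 0) at_top"
      using \<alpha> by (intro tendsto_neg_powr filterlim_ident) auto
    then have "((\<lambda>t. 1 / sqrt (A * t powr (- \<alpha>) + B)) \<longlongrightarrow> 1 / sqrt (A * 0 + B)) at_top"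
      using B by (intro tendsto_intros) auto
    then show "((\<lambda>t. 1 / sqrt (A * t powr (- \<alpha>) + B)) \<longlongrightarrow> 1 / sqrt B) at_top" by simp
    show "\<forall>\<^sub>F t in at_top. 1 / sqrt (A * t powr (- \<alpha>) + B) = t powr \<alpha> / sqrt (A * t powr \<alpha> + B * (t powr \<alpha>)\<^sup>2)"
      using eventually_gt_at_top[of 0]
    proof eventually_elim
      case (elim t)
      then have x: "0 < t powr \<alpha>" by simp
      have "A * t powr \<alpha> + B * (t powr \<alpha>)\<^sup>2 = (t powr \<alpha>)\<^sup>2 * (A * t powr (- \<alpha>) + B)"
        using x by (simp add: powr_minus field_simps power2_eq_square)
      then have "sqrt (A * t powr \<alpha> + B * (t powr \<alpha>)\<^sup>2) = t powr \<alpha> * sqrt (A * t powr (- \<alpha>) + B)"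
        using x by (simp add: real_sqrt_mult)
      then show ?case using x by simp
    qed
  qed
  have "((\<lambda>t. covariance (Nh s) (Nh t) / V * (t powr \<alpha> / sqrt (A * t powr \<alpha> + B * (t powr \<alpha>)\<^sup>2)))
      \<longlongrightarrow> K / V * (1 / sqrt B)) at_top"
    using V by (intro tendsto_intros cov sd) auto
  then have "((\<lambda>t. correlation (Nh s) (Nh t) / t powr (- \<alpha>)) \<longlongrightarrow> K / V * (1 / sqrt B)) at_top"
  proof (rule Lim_transform_eventually)
    show "\<forall>\<^sub>F t in at_top. covariance (Nh s) (Nh t) / V * (t powr \<alpha> / sqrt (A * t powr \<alpha> + B * (t powr \<alpha>)\<^sup>2))
        = correlation (Nh s) (Nh t) / t powr (- \<alpha>)"
      using eventually_gt_at_top[of 0]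
      by eventually_elim (simp add: correlation_def V_def Nh_variance A_def B_def powr_minus divide_inverse)
  qed
  then show "\<exists>c>0. ((\<lambda>t. correlation (Nh s) (Nh t) / t powr (- \<alpha>)) \<longlongrightarrow> c) at_top"
    using K V B by (intro exI[of _ "K / V * (1 / sqrt B)"]) auto
qed

end

theorem theorem4p3:
  fixes M :: "'a measure"
    and \<alpha> \<rho> lam :: real
    and k :: nat
    and N Y Nh :: "real \<Rightarrow> 'a \<Rightarrow> real"
  assumes "prob_space M"
    and "0 < \<alpha>" and "\<alpha> < 1"
    and "1 \<le> k"
    and "0 \<le> \<rho>" and "\<rho> < 1"
    and "0 < lam"
    and "prob_space.polya_aeppli_process M k lam \<rho> N"
    and "prob_space.inverse_stable_subordinator M \<alpha> Y"
    and "prob_space.indep_families M {0..} Y {0..} N"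
    and "prob_space.real_process M Nh"
    and "AE \<omega> in M. \<forall>t\<ge>0. Nh t \<omega> = N (Y t \<omega>) \<omega>"
  shows "prob_space.long_range_dependent M Nh"
proof -
  interpret prob_space M by fact
  obtain N1 :: "real \<Rightarrow> 'a \<Rightarrow> nat" and X :: "nat \<Rightarrow> 'a \<Rightarrow> nat"
    where N: "real_process N" "poisson_process lam N1" "\<forall>i\<ge>1. truncated_geometric k \<rho> (X i)"
      "indep_vars (\<lambda>_. count_space UNIV) X {1..}" "indep_families {0..} N1 {1..} X"
      "AE \<omega> in M. \<forall>t\<ge>0. N t \<omega> = real (\<Sum>i=1..N1 t \<omega>. X i \<omega>)"
    using assms(8) unfolding polya_aeppli_process_def by blast
  obtain L where Y: "real_process Y" "stable_subordinator \<alpha> L"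
      "AE \<omega> in M. \<forall>t\<ge>0. Y t \<omega> = Inf {u. u > 0 \<and> L u \<omega> > t}"
    using assms(9) unfolding inverse_stable_subordinator_def by blast
  interpret PA: polya_aeppli M k lam \<rho> N N1 X
    by unfold_locales (use assms N in auto)
  interpret time_changed M \<alpha> L Y N Nh "lam * PA.m2" "lam * PA.m1"
  proof unfold_locales
    show "0 < lam * PA.m2" "0 < lam * PA.m1"
      using truncated_geometric_moment_ge_1[OF assms(4-6), of 1] truncated_geometric_moment_ge_1[OF assms(4-6), of 2] assms(7) by auto
  qed (use assms Y PA.N_rv PA.N_path PA.N_moment PA.N_product_moment in auto)
  show ?thesis by (rule Nh_long_range_dependent)
qed

end
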